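(* Let $n\ge2$ and $G=\langle z\mapsto e^{2\pi i/n}z,\ z\mapsto 1/z\rangle\simeq D_n$. For any finite subset $\alpha\subseteq\widehat{\mathbb C}$ with $|\alpha|\ge3$, the stabilizer $\mathcal A_\alpha$ equals $G$ if and only if all five of the following hold: 1. $\alpha$ is a union of certain elements of $\{V,A_n,B_n\}\cup\{C_n(z)\mid z\in\mathbb C^*\setminus\{e^{\frac{l}{2n}2\pi i}\mid l\in\mathbb Z\}\}$; 2. for every integer $p\ge2$, $\alpha$ is not a union of certain elements of $\{V,A_{pn},B_{pn}\}\cup\{C_{pn}(z)\mid z\in\mathbb C^*\setminus\{e^{\frac{l}{2np}2\pi i}\mid l\in\mathbb Z\}\}$; 3. when $n=2$, for every integer $p\ge2$, $\alpha$ is not a union of certain elements of $\{\phi(V),\phi(A_{2p}),\phi(B_{2p})\}\cup\{\phi(C_{2p}(z))\mid z\in\mathbb C^*\setminus\{e^{\frac{l}{4p}2\pi i}\mid l\in\mathbb Z\}\}$; 4. when $n=2$, for every integer $p\ge2$, $\alpha$ is not a union of certain elements of $\{\psi(V),\psi(A_{2p}),\psi(B_{2p})\}\cup\{\psi(C_{2p}(z))\mid z\in\mathbb C^*\setminus\{e^{\frac{l}{4p}2\pi i}\mid l\in\mathbb Z\}\}$; 5. $\mathcal A_\alpha$ is not isomorphic to $A_5$, $S_4$ or $A_4$ (that is, $\alpha$ is not in the icosahedral, octahedral or tetrahedral case). Here $\phi(z)=\frac{z-1}{z+1}$ and $\psi(z)=\frac{z+i}{iz+1}$.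
   Context: $\widehat{\mathbb C}=\mathbb C\cup\{\infty\}$, $\mathbb C^*=\mathbb C\setminus\{0\}$. For $\alpha\subseteq\widehat{\mathbb C}$, $\mathcal A_\alpha$ is the group of all Möbius transformations $f\in\mathrm{PSL}(2,\mathbb C)$ with $f(\alpha)=\alpha$. $D_n$ is the dihedral group of order $2n$ (so $D_2=K_4$ is the Klein four-group). For an integer $m\ge2$: $V=\{0,\infty\}$, $A_m=\{e^{\frac{j}{m}2\pi i}\mid j\in\mathbb Z\}$, $B_m=\{e^{\frac{2j+1}{2m}2\pi i}\mid j\in\mathbb Z\}$, and $C_m(z)=\{ze^{\frac{j}{m}2\pi i}\mid j\in\mathbb Z\}\cup\{z^{-1}e^{\frac{j}{m}2\pi i}\mid j\in\mathbb Z\}$. *)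

theory Defs
  imports Complex_Main "HOL-Algebra.Generated_Groups" "HOL-Algebra.Group_Action" "HOL-Algebra.Sym_Groups"
begin

text \<open>The Riemann sphere is \<^typ>\<open>complex option\<close>, with \<^const>\<open>None\<close> as the point at infinity
  (the library uses the same representation for one-point compactifications).\<close>

type_synonym sphere = "complex option"

definition moebius :: "complex \<Rightarrow> complex \<Rightarrow> complex \<Rightarrow> complex \<Rightarrow> sphere \<Rightarrow> sphere" where
  "moebius a b c d w = (case w of
      None \<Rightarrow> if c = 0 then None else Some (a / c)
    | Some z \<Rightarrow> if c * z + d = 0 then None else Some ((a * z + b) / (c * z + d)))"

text \<open>Elements of \<open>PSL(2, \<complex>)\<close> are represented by the transformations they induce on the sphere.
  Nonzero determinant suffices: over the complex numbers the four coefficients can be rescaled to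
  determinant 1 without changing the transformation.\<close>

definition moebius_group :: "(sphere \<Rightarrow> sphere) monoid" where
  "moebius_group = \<lparr>carrier = {moebius a b c d | a b c d. a * d - b * c \<noteq> 0}, monoid.mult = (\<circ>), one = id\<rparr>"

definition moebius_stabilizer :: "sphere set \<Rightarrow> (sphere \<Rightarrow> sphere) set" where
  "moebius_stabilizer \<alpha> = stabilizer moebius_group (\<lambda>f. (`) f) \<alpha>"

definition standard_dihedral :: "nat \<Rightarrow> (sphere \<Rightarrow> sphere) set" where
  "standard_dihedral n = generate moebius_group
     {moebius (exp (2 * of_real pi * \<i> / of_nat n)) 0 0 1, moebius 0 1 1 0}"

text \<open>The abstract dihedral group of order \<open>2n\<close> (for positive \<open>n\<close>), as a semidirect product of
  the integers modulo \<open>n\<close> with a group of order two acting by negation: \<open>(i, False)\<close> stands for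
  \<open>r\<^sup>i\<close> and \<open>(i, True)\<close> for \<open>r\<^sup>i s\<close>, where \<open>s r s = r\<^sup>-\<^sup>1\<close>.\<close>

definition dihedral_group :: "nat \<Rightarrow> (int \<times> bool) monoid" where
  "dihedral_group n = \<lparr>carrier = {0..<int n} \<times> UNIV,
     monoid.mult = (\<lambda>(i, s) (j, t). ((if s then i - j else i + j) mod int n, s \<noteq> t)),
     one = (0, False)\<rparr>"

definition set_V :: "sphere set" where
  "set_V = {Some 0, None}"

definition set_A :: "nat \<Rightarrow> sphere set" where
  "set_A m = {Some (exp (of_int j / of_nat m * (2 * of_real pi * \<i>))) | j :: int. True}"

definition set_B :: "nat \<Rightarrow> sphere set" where
  "set_B m = {Some (exp (of_int (2 * j + 1) / of_nat (2 * m) * (2 * of_real pi * \<i>))) | j :: int. True}"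

definition set_C :: "nat \<Rightarrow> complex \<Rightarrow> sphere set" where
  "set_C m z =
     {Some (z * exp (of_int j / of_nat m * (2 * of_real pi * \<i>))) | j :: int. True} \<union>
     {Some (inverse z * exp (of_int j / of_nat m * (2 * of_real pi * \<i>))) | j :: int. True}"

definition orbit_family :: "nat \<Rightarrow> sphere set set" where
  "orbit_family m = {set_V, set_A m, set_B m} \<union>
     {set_C m z | z. z \<in> UNIV - {0} - {exp (of_int l / of_nat (2 * m) * (2 * of_real pi * \<i>)) | l :: int. True}}"

definition union_of_some :: "sphere set set \<Rightarrow> sphere set \<Rightarrow> bool" where
  "union_of_some \<F> \<alpha> \<longleftrightarrow> (\<exists>\<S>\<subseteq>\<F>. \<alpha> = \<Union>\<S>)"

definition phi :: "sphere \<Rightarrow> sphere" where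
  "phi = moebius 1 (-1) 1 1"

definition psi :: "sphere \<Rightarrow> sphere" where
  "psi = moebius 1 \<i> \<i> 1"

end

theory Submission
  imports Defs
begin

text \<open>The stabilizer \<open>S\<close> of a finite set with at least three points is finite, because a Moebius
  transformation is determined by its values at three points. A set is a union of members of
  \<open>orbit_family m\<close> exactly when the standard dihedral group of order \<open>2 * m\<close> maps it to itself, since
  these members are the orbits of that group; this is \<open>union_of_orbits_iff\<close>. The condition on \<open>n\<close>
  itself therefore says that \<open>S\<close> contains the standard dihedral group \<open>D\<close> of order \<open>2 * n\<close>, and the
  conditions on \<open>p * n\<close> say that \<open>S\<close> contains no larger standard dihedral group with the same
  rotation axis.

  A nontrivial Moebius transformation with only one fixed point is conjugate to a translation and
  has infinite order. So every nontrivial element of a finite group of Moebius transformations has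
  exactly two fixed points, and this property alone yields the classical list of such groups: counting
  pairs of a nontrivial element and a fixed point gives a class equation, whose solutions leave a
  common fixed point, an invariant pair of points, or a group isomorphic to \<open>A\<^sub>4\<close>, \<open>S\<^sub>4\<close> or \<open>A\<^sub>5\<close>
  (theorem \<open>classification\<close>). The three isomorphisms come from faithful actions on the four vertices of a
  tetrahedron, on the four axes through opposite vertices of a cube, and on the five octahedra
  inscribed in an icosahedral configuration of edge midpoints.

  If \<open>S\<close> contains \<open>D\<close> and is none of the three polyhedral groups, then it has an invariant pair,
  because already \<open>D\<close> has no common fixed point. The pair is also \<open>D\<close>-invariant, so it is
  \<open>{0, \<infinity>}\<close>, or \<open>n = 2\<close> and it is \<open>{1, -1}\<close> or \<open>{\<i>, -\<i>}\<close>
  (lemma \<open>dihedral_invariant_pair\<close>). The last two pairs are the images of \<open>{0, \<infinity>}\<close> under \<open>phi\<close> and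
  \<open>psi\<close>, which normalize the Klein four-group \<open>D\<close>; so all three cases reduce to the first. A finite
  group that preserves \<open>{0, \<infinity>}\<close> and contains \<open>D\<close> is a standard dihedral group of order \<open>2 * p * n\<close>
  (lemma \<open>standard_axis\<close>), and the maximality conditions force \<open>p = 1\<close>.

  Conversely, if \<open>S = D\<close>, then a violated maximality condition would place a dihedral group of larger
  order inside \<open>D\<close>. The group \<open>D\<close> is not polyhedral because its squares are rotations about one axis and
  commute, whereas \<open>A\<^sub>4\<close>, \<open>S\<^sub>4\<close> and \<open>A\<^sub>5\<close> contain 3-cycles that do not commute, and every 3-cycle is a
  square.\<close>

section \<open>Finite permutation groups\<close>

definition point_stab :: "('a \<Rightarrow> 'a) set \<Rightarrow> 'a \<Rightarrow> ('a \<Rightarrow> 'a) set" where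
  "point_stab H x = {h \<in> H. h x = x}"

definition point_orbit :: "('a \<Rightarrow> 'a) set \<Rightarrow> 'a \<Rightarrow> 'a set" where
  "point_orbit H x = (\<lambda>h. h x) ` H"

definition special_points :: "('a \<Rightarrow> 'a) set \<Rightarrow> 'a set" where
  "special_points H = {x. point_stab H x \<noteq> {id}}"

abbreviation comp_group :: "('a \<Rightarrow> 'a) set \<Rightarrow> ('a \<Rightarrow> 'a) monoid" where
  "comp_group H \<equiv> \<lparr>carrier = H, monoid.mult = (\<circ>), one = id\<rparr>"

text \<open>A group of permutations is kept as a bare set of functions, so that subgroups such as point
  stabilizers are again sets of functions on the same space and inherit every result below.\<close>

locale finite_perm_group =
  fixes H :: "('a \<Rightarrow> 'a) set"
  assumes finite_H: "finite H"
    and id_mem: "id \<in> H"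
    and comp_mem: "\<And>f g. f \<in> H \<Longrightarrow> g \<in> H \<Longrightarrow> f \<circ> g \<in> H"
    and inverse_exists: "\<And>f. f \<in> H \<Longrightarrow> \<exists>g\<in>H. g \<circ> f = id \<and> f \<circ> g = id"
begin

lemma bij: "f \<in> H \<Longrightarrow> bij f"
  using inverse_exists o_bij by blast

lemma inv_mem: "f \<in> H \<Longrightarrow> inv' f \<in> H"
  by (metis inverse_exists inv_unique_comp)

lemma inv_apply [simp]: "f \<in> H \<Longrightarrow> inv' f (f x) = x" "f \<in> H \<Longrightarrow> f (inv' f x) = x"
  using bij by (auto simp: bij_is_inj bij_is_surj surj_f_inv_f)

lemma apply_eq_iff: "f \<in> H \<Longrightarrow> f x = f y \<longleftrightarrow> x = y"
  using bij by (meson bij_is_inj inj_eq)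

lemma subgroup_group:
  assumes "K \<subseteq> H" "id \<in> K" "\<And>f g. f \<in> K \<Longrightarrow> g \<in> K \<Longrightarrow> f \<circ> g \<in> K"
    "\<And>f. f \<in> K \<Longrightarrow> inv' f \<in> K"
  shows "finite_perm_group K"
proof
  show "finite K" using assms(1) finite_H finite_subset by blast
  fix f assume "f \<in> K"
  then show "\<exists>g\<in>K. g \<circ> f = id \<and> f \<circ> g = id"
    using assms(1,4) by (intro bexI[of _ "inv' f"]) (auto simp: fun_eq_iff)
qed (use assms in auto)

lemma set_stab_group: "finite_perm_group {h \<in> H. h ` B = B}"
proof (rule subgroup_group)
  fix f assume f: "f \<in> {h \<in> H. h ` B = B}"
  then have "inv' f ` B = inv' f ` (f ` B)" by simp
  also have "\<dots> = (\<lambda>x. inv' f (f x)) ` B" by (rule image_image)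
  also have "\<dots> = B" using f by simp
  finally show "inv' f \<in> {h \<in> H. h ` B = B}" using f inv_mem by simp
next
  fix f g assume "f \<in> {h \<in> H. h ` B = B}" "g \<in> {h \<in> H. h ` B = B}"
  then show "f \<circ> g \<in> {h \<in> H. h ` B = B}"
    using image_comp[of f g B] by (auto simp: comp_mem)
qed (auto simp: id_mem)

lemma point_stab_group: "finite_perm_group (point_stab H x)"
proof (rule subgroup_group)
  fix f assume f: "f \<in> point_stab H x"
  then show "inv' f \<in> point_stab H x"
    using inv_apply(1)[of f x] inv_mem by (simp add: point_stab_def)
qed (auto simp: id_mem comp_mem point_stab_def)

lemma group_H: "group (comp_group H)"
proof (rule groupI)
  fix f assume "f \<in> carrier (comp_group H)"
  then show "\<exists>g\<in>carrier (comp_group H).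
      g \<otimes>\<^bsub>comp_group H\<^esub> f
        = \<one>\<^bsub>comp_group H\<^esub>"
    using inverse_exists[of f] by auto
qed (simp_all add: id_mem comp_mem comp_assoc)

lemma card_dvd:
  assumes "finite_perm_group K" "K \<subseteq> H"
  shows "card K dvd card H"
proof -
  interpret K: finite_perm_group K by fact
  interpret G: group "comp_group H" by (rule group_H)
  have "subgroup K (comp_group H)"
  proof (rule G.subgroupI)
    fix f assume f: "f \<in> K"
    have "inv\<^bsub>comp_group H\<^esub> f = inv' f"
      by (rule G.inv_equality) (use f assms(2) inv_mem in \<open>auto simp: fun_eq_iff\<close>)
    then show "inv\<^bsub>comp_group H\<^esub> f \<in> K"
      using K.inv_mem f by simp
  qed (use assms K.id_mem K.comp_mem in auto)
  from G.lagrange[OF this] show ?thesis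
    by (metis dvd_triv_right order_def partial_object.select_convs(1))
qed

text \<open>The action is a parameter because the group acts on points and, through images, on sets of
  points (axes and inscribed octahedra). The fibres of \<open>\<lambda>h. act h x\<close> are the cosets of the stabilizer.\<close>

lemma orbit_stabilizer:
  assumes act_id: "act id x = x"
    and act_comp: "\<And>f g. f \<in> H \<Longrightarrow> g \<in> H \<Longrightarrow> act (f \<circ> g) x = act f (act g x)"
  shows "card ((\<lambda>h. act h x) ` H) * card {h \<in> H. act h x = x} = card H"
proof -
  have fibre: "card {h \<in> H. act h x = act g x} = card {h \<in> H. act h x = x}" if g: "g \<in> H" for g
  proof (rule bij_betw_same_card[symmetric], rule bij_betwI)
    show "(\<circ>) g \<in> {h \<in> H. act h x = x} \<rightarrow> {h \<in> H. act h x = act g x}"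
      using g by (auto simp: comp_mem act_comp)
    have "act (inv' g \<circ> h) x = x" if "h \<in> H" "act h x = act g x" for h
    proof -
      have "act (inv' g \<circ> h) x = act (inv' g) (act g x)"
        using g that by (simp add: act_comp inv_mem)
      also have "\<dots> = act (inv' g \<circ> g) x"
        using g by (simp add: act_comp inv_mem)
      also have "inv' g \<circ> g = id" using g by (auto simp: fun_eq_iff)
      finally show ?thesis by (simp only: act_id)
    qed
    then show "(\<circ>) (inv' g) \<in> {h \<in> H. act h x = act g x} \<rightarrow> {h \<in> H. act h x = x}"
      using g inv_mem by (auto simp: comp_mem)
  qed (use g in \<open>auto simp: fun_eq_iff\<close>)
  have "card H = (\<Sum>y\<in>(\<lambda>h. act h x) ` H. card {h \<in> H. act h x = y})"
    using sum.image_gen[OF finite_H, of "\<lambda>_. 1::nat" "\<lambda>h. act h x"] by simp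
  also have "\<dots> = (\<Sum>y\<in>(\<lambda>h. act h x) ` H. card {h \<in> H. act h x = x})"
    by (rule sum.cong) (auto simp: fibre)
  finally show ?thesis by simp
qed

lemma card_orbit_stab: "card (point_orbit H x) * card (point_stab H x) = card H"
  unfolding point_orbit_def point_stab_def by (rule orbit_stabilizer) auto

lemma card_orbit_image_stab:
  "card ((\<lambda>h. h ` B) ` H) * card {h \<in> H. h ` B = B} = card H"
  using orbit_stabilizer[of "\<lambda>h B. h ` B" B] by (simp add: image_comp)

lemma card_H_pos: "card H > 0"
  using finite_H id_mem by (auto simp: card_gt_0_iff)

lemma self_mem_orbit: "x \<in> point_orbit H x"
  unfolding point_orbit_def by (rule image_eqI[OF _ id_mem]) simp

lemma finite_orbit: "finite (point_orbit H x)"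
  by (simp add: point_orbit_def finite_H)

lemma orbit_eq: "y \<in> point_orbit H x \<Longrightarrow> point_orbit H y = point_orbit H x"
proof -
  assume "y \<in> point_orbit H x"
  then obtain g where g: "g \<in> H" "y = g x" by (auto simp: point_orbit_def)
  have "h x \<in> (\<lambda>h. h (g x)) ` H" if "h \<in> H" for h
    by (rule image_eqI[of _ _ "h \<circ> inv' g"]) (use g that in \<open>auto simp: comp_mem inv_mem\<close>)
  moreover have "h (g x) \<in> (\<lambda>h. h x) ` H" if "h \<in> H" for h
    by (rule image_eqI[of _ _ "h \<circ> g"]) (use g that in \<open>auto simp: comp_mem\<close>)
  ultimately show ?thesis using g by (auto simp: point_orbit_def)
qed

lemma card_stab_orbit: "y \<in> point_orbit H x \<Longrightarrow> card (point_stab H y) = card (point_stab H x)"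
  by (metis card_orbit_stab card_H_pos orbit_eq mult_cancel1 mult_is_0 not_gr0)

lemma orbit_image: "h \<in> H \<Longrightarrow> h ` point_orbit H x = point_orbit H x"
proof -
  assume h: "h \<in> H"
  have "h ` point_orbit H x \<subseteq> point_orbit H x"
  proof (clarsimp simp: point_orbit_def)
    fix g assume "g \<in> H"
    then show "h (g x) \<in> (\<lambda>h. h x) ` H"
      using h by (intro image_eqI[of _ _ "h \<circ> g"]) (auto simp: comp_mem)
  qed
  moreover have "inj_on h (point_orbit H x)" using apply_eq_iff[OF h] by (auto intro: inj_onI)
  ultimately show ?thesis using endo_inj_surj finite_orbit by blast
qed

lemma stab_conj: "h \<in> H \<Longrightarrow> point_stab H (h x) = (\<lambda>f. h \<circ> f \<circ> inv' h) ` point_stab H x"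
proof (intro equalityI subsetI)
  fix g assume h: "h \<in> H" and g: "g \<in> point_stab H (h x)"
  show "g \<in> (\<lambda>f. h \<circ> f \<circ> inv' h) ` point_stab H x"
    by (rule image_eqI[of _ _ "inv' h \<circ> g \<circ> h"])
       (use h g in \<open>auto simp: point_stab_def fun_eq_iff comp_mem inv_mem\<close>)
qed (auto simp: point_stab_def comp_mem inv_mem)

lemma stab_eq_imp_stab_image_eq:
  "h \<in> H \<Longrightarrow> point_stab H x = point_stab H y \<Longrightarrow> point_stab H (h x) = point_stab H (h y)"
  by (simp add: stab_conj)

lemma special_iff: "x \<in> special_points H \<longleftrightarrow> (\<exists>h\<in>H. h \<noteq> id \<and> h x = x)"
  using id_mem by (auto simp: special_points_def point_stab_def)

lemma special_iff_card: "x \<in> special_points H \<longleftrightarrow> card (point_stab H x) \<ge> 2"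
proof -
  interpret S: finite_perm_group "point_stab H x" by (rule point_stab_group)
  have "card (point_stab H x) = 1 \<longleftrightarrow> point_stab H x = {id}"
    using S.id_mem by (auto simp: card_1_singleton_iff)
  then show ?thesis using S.card_H_pos by (auto simp: special_points_def)
qed

lemma special_orbit: "x \<in> special_points H \<Longrightarrow> y \<in> point_orbit H x \<Longrightarrow> y \<in> special_points H"
  by (simp add: special_iff_card card_stab_orbit)

end

text \<open>The partition is presented by the block of each element, the form in which axes and inscribed
  octahedra arise.\<close>

lemma card_blocks:
  assumes "finite S" "\<And>x. x \<in> S \<Longrightarrow> x \<in> f x \<and> f x \<subseteq> S \<and> card (f x) = c"
    and "\<And>x y. x \<in> S \<Longrightarrow> y \<in> f x \<Longrightarrow> f y = f x"
  shows "card (f ` S) * c = card S"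
proof -
  have U: "\<Union> (f ` S) = S" using assms(2) by blast
  have "c * card (f ` S) = card (\<Union> (f ` S))"
  proof (rule card_partition)
    show "finite (\<Union> (f ` S))" using U assms(1) by simp
    show "A \<inter> B = {}" if AB: "A \<in> f ` S" "B \<in> f ` S" "A \<noteq> B" for A B
    proof (rule ccontr)
      assume "A \<inter> B \<noteq> {}"
      then obtain z where "z \<in> A" "z \<in> B" by blast
      then have "f z = A" "f z = B" using AB assms(3) by auto
      then show False using AB(3) by simp
    qed
    show "finite (f ` S)" using assms(1) by simp
    show "card A = c" if "A \<in> f ` S" for A using that assms(2) by blast
  qed
  then show ?thesis using U by (simp add: mult.commute)
qed

section \<open>Groups whose nontrivial elements fix exactly two points\<close>

text \<open>The only geometric property of finite groups of Moebius transformations that enters their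
  classification.\<close>

locale two_point_group = finite_perm_group +
  assumes two_fixed_points: "\<And>h. h \<in> H \<Longrightarrow> h \<noteq> id \<Longrightarrow> card {x. h x = x} = 2"
begin

lemma two_point_subgroup: "finite_perm_group K \<Longrightarrow> K \<subseteq> H \<Longrightarrow> two_point_group K"
  unfolding two_point_group_def two_point_group_axioms_def using two_fixed_points by blast

lemma finite_fixed: "h \<in> H \<Longrightarrow> h \<noteq> id \<Longrightarrow> finite {x. h x = x}"
  using two_fixed_points by (metis card.infinite zero_neq_numeral)

lemma finite_special: "finite (special_points H)"
proof -
  have "special_points H = (\<Union>h\<in>H - {id}. {x. h x = x})"
    by (auto simp: special_iff)
  then show ?thesis using finite_H finite_fixed by auto
qed

text \<open>Both sides count the pairs of a nontrivial element and one of its fixed points.\<close>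

lemma sum_stab_special:
  "(\<Sum>x\<in>special_points H. card (point_stab H x) - 1) = 2 * (card H - 1)"
proof -
  have "(\<Sum>x\<in>special_points H. card (point_stab H x) - 1)
      = (\<Sum>x\<in>special_points H. card {h \<in> H - {id}. h x = x})"
  proof (rule sum.cong)
    fix x
    have "{h \<in> H - {id}. h x = x} = point_stab H x - {id}" by (auto simp: point_stab_def)
    then show "card (point_stab H x) - 1 = card {h \<in> H - {id}. h x = x}"
      using id_mem by (simp add: point_stab_def)
  qed simp
  also have "\<dots> = (\<Sum>h\<in>H - {id}. card {x \<in> special_points H. h x = x})"
    by (rule sum_multicount_gen) (auto simp: finite_H finite_special)
  also have "\<dots> = (\<Sum>h\<in>H - {id}. 2)"
  proof (rule sum.cong)
    fix h assume h: "h \<in> H - {id}"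
    then have "{x \<in> special_points H. h x = x} = {x. h x = x}" by (auto simp: special_iff)
    then show "card {x \<in> special_points H. h x = x} = 2" using two_fixed_points h by simp
  qed simp
  also have "\<dots> = 2 * (card H - 1)" using id_mem finite_H by simp
  finally show ?thesis .
qed

abbreviation special_orbits :: "'a set set" where
  "special_orbits \<equiv> point_orbit H ` special_points H"

lemma sum_special_orbits:
  "(\<Sum>x\<in>special_points H. f x) = (\<Sum>Q\<in>special_orbits. \<Sum>x\<in>Q. f x)"
proof -
  have "{x \<in> special_points H. point_orbit H x = Q} = Q" if "Q \<in> special_orbits" for Q
    using that orbit_eq self_mem_orbit special_orbit by blast
  then show ?thesis
    by (subst sum.image_gen[OF finite_special, of _ "point_orbit H"]) (auto intro: sum.cong)
qed

text \<open>Each special orbit contributes \<open>card H\<close> to the sum of the stabilizer orders over the special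
  points, and that sum is known from the double count. In the usual form this reads
  \<open>\<Sum>(1 - 1/r) = 2 - 2/N\<close>, the sum ranging over the special orbits, with \<open>r\<close> their stabilizer orders.\<close>

lemma class_equation: "card special_orbits * card H + 2 = card (special_points H) + 2 * card H"
proof -
  have "card special_orbits * card H = (\<Sum>Q\<in>special_orbits. card H)" by simp
  also have "\<dots> = (\<Sum>Q\<in>special_orbits. \<Sum>x\<in>Q. card (point_stab H x))"
  proof (rule sum.cong)
    fix Q assume "Q \<in> special_orbits"
    then obtain x where Q: "Q = point_orbit H x" by auto
    show "card H = (\<Sum>x\<in>Q. card (point_stab H x))"
      unfolding Q by (simp add: card_stab_orbit card_orbit_stab)
  qed simp
  also have "\<dots> = (\<Sum>x\<in>special_points H. card (point_stab H x))"
    by (rule sum_special_orbits[symmetric])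
  also have "\<dots> = (\<Sum>x\<in>special_points H. (card (point_stab H x) - 1) + 1)"
    by (rule sum.cong) (auto simp: special_iff_card)
  also have "\<dots> = 2 * (card H - 1) + card (special_points H)"
    by (simp only: sum.distrib sum_stab_special) simp
  finally show ?thesis using card_H_pos by simp
qed

lemma card_special: "card (special_points H) = (\<Sum>Q\<in>special_orbits. card Q)"
  unfolding card_eq_sum by (rule sum_special_orbits)

lemma special_orbit_card:
  assumes "x \<in> special_points H"
  shows "2 * card (point_orbit H x) \<le> card H"
  using card_orbit_stab[of x] assms[unfolded special_iff_card]
  by (metis mult.commute mult_le_mono1)

text \<open>A point stabilizer \<open>S\<close> is itself a two-point group, and the fixed point \<open>x\<close> is one of its
  special orbits. All other special orbits have at most half the size of \<open>S\<close>, so the class equation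
  for \<open>S\<close> leaves room for only one of them, and it is again a single point. Hence the whole of \<open>S\<close>
  fixes the second fixed point of any of its elements.\<close>

lemma stab_determined:
  assumes h: "h \<in> H" "h \<noteq> id" "h x = x" "h y = y"
  shows "point_stab H x = point_stab H y"
proof -
  have sub: "point_stab H x \<subseteq> point_stab H y" if xy: "x \<noteq> y" "h x = x" "h y = y" for x y
  proof -
    define S where "S = point_stab H x"
    interpret S: two_point_group S
      using two_point_subgroup point_stab_group by (auto simp: S_def point_stab_def)
    have hS: "h \<in> S" using h(1) xy by (simp add: S_def point_stab_def)
    have x: "x \<in> special_points S" and y: "y \<in> special_points S"
      using hS h(2) xy by (auto simp: S.special_iff)
    have ox: "point_orbit S x = {x}"
      using S.id_mem by (auto simp: point_orbit_def S_def point_stab_def)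
    have fin: "finite S.special_orbits" using S.finite_special by simp
    let ?rest = "S.special_orbits - {{x}}"
    have mem: "{x} \<in> S.special_orbits" using x ox by (metis image_eqI)
    have "card (special_points S) = (\<Sum>Q\<in>S.special_orbits. card Q)" by (rule S.card_special)
    also have "\<dots> = 1 + (\<Sum>Q\<in>?rest. card Q)"
      using sum.remove[OF fin mem, of card] by simp
    finally have c: "card (special_points S) = 1 + (\<Sum>Q\<in>?rest. card Q)" .
    have "2 * (\<Sum>Q\<in>?rest. card Q) = (\<Sum>Q\<in>?rest. 2 * card Q)"
      by (simp add: sum_distrib_left)
    also have "\<dots> \<le> (\<Sum>Q\<in>?rest. card S)"
      by (rule sum_mono) (use S.special_orbit_card in auto)
    also have "\<dots> = (card S.special_orbits - 1) * card S" using fin mem by simp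
    finally have r: "2 * (\<Sum>Q\<in>?rest. card Q) \<le> (card S.special_orbits - 1) * card S" .
    have "card S.special_orbits \<noteq> 0" using fin mem by auto
    then obtain j where j: "card S.special_orbits = Suc j" by (cases "card S.special_orbits") auto
    have "j * card S + 2 \<le> 2 * card S"
      using S.class_equation c r j by simp
    then have "j * card S < 2 * card S" by linarith
    then have "j \<le> 1" by simp
    then have "j * card S \<le> 1 * card S" by (rule mult_le_mono1)
    then have "card (special_points S) \<le> 2"
      using S.class_equation unfolding j mult_Suc by linarith
    moreover have "{x, y} \<subseteq> special_points S" using x y by simp
    ultimately have P: "special_points S = {x, y}"
      using xy(1) card_seteq[OF S.finite_special, of "{x, y}"] by simp
    show ?thesis
    proof
      fix g assume g: "g \<in> point_stab H x"
      then have "g y \<in> point_orbit S y" by (auto simp: point_orbit_def S_def)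
      then have "g y \<in> {x, y}" using S.special_orbit[OF y] P by blast
      moreover have "g y \<noteq> x"
        using g xy(1) apply_eq_iff[of g y x] by (auto simp: point_stab_def)
      ultimately show "g \<in> point_stab H y" using g by (auto simp: point_stab_def)
    qed
  qed
  show ?thesis
  proof (cases "x = y")
    case False
    then show ?thesis using sub[of x y] sub[of y x] h by auto
  qed simp
qed

text \<open>For a special point this is the pair of fixed points of its stabilizer: the two ends of a
  rotation axis.\<close>

definition axis :: "'a \<Rightarrow> 'a set" where
  "axis x = {y. point_stab H y = point_stab H x}"

lemma self_mem_axis: "x \<in> axis x"
  by (simp add: axis_def)

lemma axis_eq: "y \<in> axis x \<Longrightarrow> axis y = axis x"
  by (auto simp: axis_def)

lemma axis_eq_fixed:
  assumes "h \<in> H" "h \<noteq> id" "h x = x"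
  shows "axis x = {y. h y = y}"
proof (intro equalityI subsetI)
  fix y assume "y \<in> axis x"
  then have "h \<in> point_stab H y" using assms by (simp add: axis_def point_stab_def)
  then show "y \<in> {y. h y = y}" by (simp add: point_stab_def)
next
  fix y assume "y \<in> {y. h y = y}"
  then show "y \<in> axis x" using stab_determined[OF assms, of y] by (simp add: axis_def)
qed

lemma card_axis: "x \<in> special_points H \<Longrightarrow> card (axis x) = 2"
  unfolding special_iff using axis_eq_fixed two_fixed_points by auto

lemma image_axis: "h \<in> H \<Longrightarrow> h ` axis x = axis (h x)"
proof (intro equalityI subsetI)
  fix y assume h: "h \<in> H" and y: "y \<in> axis (h x)"
  have "point_stab H (inv' h y) = point_stab H (inv' h (h x))"
    by (rule stab_eq_imp_stab_image_eq) (use h y in \<open>auto simp: inv_mem axis_def\<close>)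
  then have "inv' h y \<in> axis x" using h by (simp add: axis_def)
  then show "y \<in> h ` axis x" using h by (intro image_eqI[of _ _ "inv' h y"]) auto
next
  fix y assume h: "h \<in> H" and "y \<in> h ` axis x"
  then obtain z where "y = h z" "point_stab H z = point_stab H x" by (auto simp: axis_def)
  then show "y \<in> axis (h x)"
    using stab_eq_imp_stab_image_eq[OF h, of z x] by (simp add: axis_def)
qed

lemma axis_subset_special: "x \<in> special_points H \<Longrightarrow> axis x \<subseteq> special_points H"
  by (auto simp: axis_def special_points_def)

lemma card_orbit_axis: "y \<in> axis x \<Longrightarrow> card (point_orbit H y) = card (point_orbit H x)"
proof -
  assume "y \<in> axis x"
  then have "card (point_orbit H y) * card (point_stab H x)
      = card (point_orbit H x) * card (point_stab H x)"
    using card_orbit_stab[of x] card_orbit_stab[of y] by (simp add: axis_def)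
  moreover have "card (point_stab H x) \<noteq> 0"
    using card_orbit_stab[of x] card_H_pos by (metis less_irrefl mult_0_right)
  ultimately show ?thesis by simp
qed

text \<open>If the square of \<open>h\<close> were nontrivial, its only fixed points would be \<open>x\<close> and \<open>y\<close>; but it also fixes
  the fixed points of \<open>h\<close>, and \<open>h\<close> moves \<open>x\<close> and \<open>y\<close>.\<close>

lemma swap_imp_involution:
  assumes h: "h \<in> H" and xy: "x \<noteq> y" "h x = y" "h y = x"
  shows "h \<circ> h = id"
proof (rule ccontr)
  assume ne: "h \<circ> h \<noteq> id"
  have hid: "h \<noteq> id" using xy by auto
  have "card {z. h z = z} = 2" using two_fixed_points h hid by blast
  then have "{z. h z = z} \<noteq> {}" by (metis card.empty zero_neq_numeral)
  then obtain u where u: "h u = u" by auto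
  have "card {z. (h \<circ> h) z = z} = 2" using two_fixed_points h ne comp_mem by blast
  moreover have "{x, y} \<subseteq> {z. (h \<circ> h) z = z}" using xy by simp
  ultimately have "{x, y} = {z. (h \<circ> h) z = z}"
    using xy(1) finite_fixed[OF _ ne] comp_mem[OF h h] by (intro card_subset_eq) auto
  then have "u \<in> {x, y}" using u by simp
  then show False using u xy by auto
qed

end

text \<open>The solutions of the class equation with three special orbits of sizes \<open>a\<close>, \<open>b\<close>, \<open>c\<close> and stabilizer
  orders \<open>p\<close>, \<open>q\<close>, \<open>r\<close>. The types \<open>(2, 2, r)\<close> give \<open>c = 2\<close>; what remains is \<open>(2, 3, 3)\<close>, \<open>(2, 3, 4)\<close>
  and \<open>(2, 3, 5)\<close>.\<close>

lemma orbit_size_arithmetic: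
  fixes a b c p q r N :: nat
  assumes "a * p = N" "b * q = N" "c * r = N" "p \<ge> 2" "q \<ge> 2" "r \<ge> 2"
    and sum: "a + b + c = N + 2" and sorted: "c \<le> b" "b \<le> a"
  shows "c = 2 \<or> (N = 12 \<and> c = 4) \<or> (N = 24 \<and> a = 12 \<and> b = 8 \<and> c = 6)
    \<or> (N = 60 \<and> a = 30 \<and> b = 20 \<and> c = 12)"
proof -
  have "p < 3"
  proof (rule ccontr)
    assume "\<not> p < 3"
    then have "a * 3 \<le> a * p" by (intro mult_le_mono) auto
    then show False using assms by linarith
  qed
  then have p: "2 * a = N" using assms by (cases "p = 2") auto
  have "q < 4"
  proof (rule ccontr)
    assume "\<not> q < 4"
    then have "b * 4 \<le> b * q" by (intro mult_le_mono) auto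
    then show False using assms p by linarith
  qed
  then consider "q = 2" | "q = 3" using assms by linarith
  then show ?thesis
  proof cases
    case 1
    then have "2 * b = N" using assms by simp
    then have "c = 2" using p sum by linarith
    then show ?thesis ..
  next
    case 2
    then have b: "3 * b = 2 * a" using assms p by simp
    \<comment> \<open>in terms of \<open>t\<close> the remaining unknowns satisfy \<open>(t + 2) * r = 6 * t\<close>\<close>
    define t where "t = b div 2"
    have "even (3 * b)" unfolding b by simp
    then have "b = 2 * t" by (simp add: t_def)
    then have t: "a = 3 * t" "b = 2 * t" "N = 6 * t" "c = t + 2" using p b sum by linarith+
    have rt: "(t + 2) * r = 6 * t" using t assms by simp
    have "r < 6"
    proof (rule ccontr)
      assume "\<not> r < 6"
      then have "(t + 2) * 6 \<le> (t + 2) * r" by (intro mult_le_mono) auto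
      then show False unfolding rt by simp
    qed
    then consider "r = 2" | "r = 3" | "r = 4" | "r = 5" using assms by linarith
    then show ?thesis
      by cases (use t rt sorted in auto)
  qed
qed

section \<open>Recognising symmetric and alternating groups\<close>

text \<open>A subgroup of index two contains all squares. Every 3-cycle is the square of its own square, and
  the 3-cycles generate the alternating group.\<close>

lemma index_two_subgroup_of_sym_group:
  assumes K: "subgroup K (sym_group k)" and index: "2 * card K = fact k" and k: "k \<ge> 2"
  shows "K = carrier (alt_group k)"
proof -
  interpret S: group "sym_group k" by (rule sym_group_is_group)
  have fin: "finite (carrier (sym_group k))"
    by (rule card_ge_0_finite) (simp add: sym_group_card_carrier)
  have finK: "finite K" using fin subgroup.subset[OF K] finite_subset by blast
  have square: "g \<circ> g \<in> K" if g: "g \<in> carrier (sym_group k)" for g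
  proof (rule ccontr)
    assume sq: "g \<circ> g \<notin> K"
    have gK: "g \<notin> K" using sq subgroup.m_closed[OF K, of g g] by (auto simp: sym_group_mult)
    have comp: "(\<circ>) g ` K \<subseteq> carrier (sym_group k)"
      using g subgroup.subset[OF K] S.m_closed by (auto simp: sym_group_mult)
    have injg: "inj g" using g permutes_inj by (auto simp: sym_group_carrier)
    then have inj: "inj_on ((\<circ>) g) K" by (auto simp: inj_on_def fun_eq_iff)
    have disj: "(\<circ>) g ` K \<inter> K = {}"
    proof -
      have "g \<in> K" if gh: "g \<circ> h \<in> K" and h: "h \<in> K" for h
      proof -
        have hS: "h \<in> carrier (sym_group k)" using h subgroup.subset[OF K] by blast
        then have "inv' h \<in> K"
          using subgroup.m_inv_closed[OF K h] by simp
        then have "(g \<circ> h) \<circ> inv' h \<in> K"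
          using subgroup.m_closed[OF K gh] by (simp add: sym_group_mult)
        moreover have "(g \<circ> h) \<circ> inv' h = g"
          using hS permutes_inv_o(1) by (metis comp_assoc comp_id sym_group_carrier)
        ultimately show ?thesis by simp
      qed
      then show ?thesis using gK by auto
    qed
    have "card ((\<circ>) g ` K \<union> K) = fact k"
      using disj finK card_image[OF inj] index by (simp add: card_Un_disjoint)
    then have "(\<circ>) g ` K \<union> K = carrier (sym_group k)"
      using comp subgroup.subset[OF K] fin
      by (intro card_subset_eq) (auto simp: sym_group_card_carrier)
    moreover have "g \<circ> g \<in> carrier (sym_group k)" using S.m_closed[OF g g] by (simp add: sym_group_mult)
    ultimately obtain h where h: "h \<in> K" "g \<circ> g = g \<circ> h" using sq by auto
    then have "g = h"
      using injg by (auto simp: fun_eq_iff inj_eq)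
    then show False using h gK by simp
  qed
  have cycles: "three_cycles k \<subseteq> K"
  proof
    fix p assume p: "p \<in> three_cycles k"
    then obtain cs where cs: "p = cycle_of_list cs" "cycle cs" "length cs = 3" "set cs \<subseteq> {1..k}"
      by auto
    have pS: "p \<in> carrier (sym_group k)"
      using p three_cycles_incl alt_group_carrier sym_group_carrier by blast
    obtain a b c where abc: "cs = [a, b, c]"
      using stupid_lemma[OF cs(3)] by auto
    have "p \<circ> p \<circ> p = id"
      using cs(2) unfolding cs(1) abc by (auto simp: fun_eq_iff transpose_def)
    then have "p = (p \<circ> p) \<circ> (p \<circ> p)" by (simp add: comp_assoc[symmetric])
    then show "p \<in> K" using square[of "p \<circ> p"] S.m_closed[OF pS pS] by (simp add: sym_group_mult)
  qed
  have "generate (sym_group k) (three_cycles k) \<subseteq> K"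
    by (rule S.generate_subgroup_incl[OF cycles K])
  moreover have "generate (alt_group k) (three_cycles k) = generate (sym_group k) (three_cycles k)"
    using S.generate_consistent[OF three_cycles_incl alt_group_is_subgroup]
    by (simp add: alt_group_def)
  ultimately have "carrier (alt_group k) \<subseteq> K"
    by (subst alt_group_carrier_as_three_cycles) simp
  moreover have "card (carrier (alt_group k)) = card K"
    using alt_group_card_carrier[OF k] index by simp
  ultimately show ?thesis using finK by (metis card_subset_eq)
qed

context finite_perm_group
begin

text \<open>Numbering the points of \<open>X\<close> turns the action into permutations of \<open>{1..k}\<close>.\<close>

lemma faithful_action_embedding:
  assumes X: "finite X" "card X = k"
    and act_closed: "\<And>h x. h \<in> H \<Longrightarrow> x \<in> X \<Longrightarrow> act h x \<in> X"
    and act_id: "\<And>x. x \<in> X \<Longrightarrow> act id x = x"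
    and act_comp: "\<And>f g x. f \<in> H \<Longrightarrow> g \<in> H \<Longrightarrow> x \<in> X \<Longrightarrow> act (f \<circ> g) x = act f (act g x)"
    and faithful: "\<And>h. h \<in> H \<Longrightarrow> (\<And>x. x \<in> X \<Longrightarrow> act h x = x) \<Longrightarrow> h = id"
  obtains F where "F \<in> hom (comp_group H) (sym_group k)" "inj_on F H"
proof -
  obtain e where e: "bij_betw e {1..k} X"
    using ex_bij_betw_nat_finite_1[OF X(1)] X(2) by auto
  define d where "d = inv_into {1..k} e"
  have d: "d x \<in> {1..k}" "e (d x) = x" if "x \<in> X" for x
    using e that bij_betw_inv_into_right[OF e] bij_betw_apply[OF bij_betw_inv_into[OF e]]
    by (auto simp: d_def)
  have e': "e i \<in> X" "d (e i) = i" if "i \<in> {1..k}" for i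
    using e that bij_betw_inv_into_left[OF e] bij_betw_apply[OF e] by (auto simp: d_def)
  define F where "F = (\<lambda>h i. if i \<in> {1..k} then d (act h (e i)) else i)"
  have F_id: "F id = id" by (auto simp: F_def fun_eq_iff e' act_id)
  have F_comp: "F (f \<circ> g) = F f \<circ> F g" if "f \<in> H" "g \<in> H" for f g
  proof
    fix i show "F (f \<circ> g) i = (F f \<circ> F g) i"
      using that d e' act_closed
      by (cases "i \<in> {1..k}") (simp_all add: F_def act_comp del: atLeastAtMost_iff)
  qed
  have F_inv: "F (inv' h) \<circ> F h = id" "F h \<circ> F (inv' h) = id" if h: "h \<in> H" for h
  proof -
    have "inv' h \<circ> h = id" "h \<circ> inv' h = id" using h by (auto simp: fun_eq_iff)
    then show "F (inv' h) \<circ> F h = id" "F h \<circ> F (inv' h) = id"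
      using F_comp[OF inv_mem[OF h] h] F_comp[OF h inv_mem[OF h]] F_id by simp_all
  qed
  have perm: "F h permutes {1..k}" if h: "h \<in> H" for h
  proof (rule bij_imp_permutes)
    show "bij_betw (F h) {1..k} {1..k}"
    proof (rule bij_betwI)
      show "F h \<in> {1..k} \<rightarrow> {1..k}" "F (inv' h) \<in> {1..k} \<rightarrow> {1..k}"
        using d e' act_closed h inv_mem[OF h] by (auto simp: F_def)
    qed (use F_inv[OF h] in \<open>simp_all add: fun_eq_iff\<close>)
  qed (auto simp: F_def)
  have "inj_on F H"
  proof (rule inj_onI)
    fix f g assume fg: "f \<in> H" "g \<in> H" "F f = F g"
    have "F (inv' g \<circ> f) = id"
      using F_comp[of "inv' g" f] F_inv(1)[of g] fg inv_mem by simp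
    then have "act (inv' g \<circ> f) x = x" if "x \<in> X" for x
    proof -
      have "F (inv' g \<circ> f) (d x) = d x" using \<open>F (inv' g \<circ> f) = id\<close> by simp
      then have "d (act (inv' g \<circ> f) x) = d x" using d[OF that] by (simp add: F_def)
      then show ?thesis
        using d(2)[OF that] d(2)[OF act_closed[OF _ that]] fg by (metis comp_mem inv_mem)
    qed
    then have "inv' g \<circ> f = id" using faithful comp_mem inv_mem fg by blast
    then have "g \<circ> (inv' g \<circ> f) = g" by simp
    moreover have "g \<circ> (inv' g \<circ> f) = f" using fg by (simp add: fun_eq_iff)
    ultimately show "f = g" by simp
  qed
  moreover have "F \<in> hom (comp_group H) (sym_group k)"
    using perm F_comp by (auto simp: hom_def sym_group_def)
  ultimately show ?thesis using that by blast
qed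

lemma iso_sym_group:
  assumes F: "F \<in> hom (comp_group H) (sym_group k)" "inj_on F H" and card: "card H = fact k"
  shows "comp_group H \<cong> sym_group k"
proof -
  have "F ` H \<subseteq> carrier (sym_group k)" using F(1) by (auto simp: hom_def)
  moreover have "finite (carrier (sym_group k))"
    by (rule card_ge_0_finite) (simp add: sym_group_card_carrier)
  ultimately have "F ` H = carrier (sym_group k)"
    using card card_image[OF F(2)] by (intro card_subset_eq) (simp_all add: sym_group_card_carrier)
  then have "F \<in> iso (comp_group H) (sym_group k)" using F by (simp add: iso_def bij_betw_def)
  then show ?thesis by (auto simp: is_iso_def)
qed

lemma iso_alt_group:
  assumes F: "F \<in> hom (comp_group H) (sym_group k)" "inj_on F H"
    and card: "2 * card H = fact k" and k: "k \<ge> 2"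
  shows "comp_group H \<cong> alt_group k"
proof -
  interpret h: group_hom "comp_group H" "sym_group k" F
    by (intro group_hom.intro group_hom_axioms.intro group_H sym_group_is_group F(1))
  have "F ` H = carrier (alt_group k)"
    using index_two_subgroup_of_sym_group[OF h.img_is_subgroup] card card_image[OF F(2)] k by simp
  then have "F \<in> iso (comp_group H) (alt_group k)"
    using F by (auto simp: iso_def bij_betw_def hom_def alt_group_mult sym_group_mult)
  then show ?thesis by (auto simp: is_iso_def)
qed

end

section \<open>Classification of two-point groups\<close>

context two_point_group
begin

text \<open>Special orbits have between two and \<open>card H / 2\<close> elements once there is no common fixed point. By the
  class equation there are fewer than four of them; one is impossible, and two would both be
  single points, so there are three, and their sizes are known.\<close>

lemma orbit_type_cases:
  assumes no_fix: "\<nexists>x. \<forall>h\<in>H. h x = x"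
  obtains (pair) x where "card (point_orbit H x) = 2"
    | (tetrahedral) x where "card H = 12" "card (point_orbit H x) = 4"
    | (octahedral) "card H = 24" "card ` special_orbits = {12, 8, 6}" "inj_on card special_orbits"
    | (icosahedral) "card H = 60" "card ` special_orbits = {30, 20, 12}" "inj_on card special_orbits"
proof -
  let ?k = "card special_orbits" and ?N = "card H"
  have fin: "finite special_orbits" using finite_special by simp
  have "H \<noteq> {id}" using no_fix by auto
  then obtain h where h: "h \<in> H" "h \<noteq> id" using id_mem by blast
  then have "card {id, h} \<le> ?N" using finite_H id_mem by (intro card_mono) auto
  then have N: "?N \<ge> 2" using h by simp
  have size_pos: "card Q \<ge> 1" if "Q \<in> special_orbits" for Q
    using that self_mem_orbit finite_orbit by (force simp: Suc_le_eq card_gt_0_iff)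
  have size_ne_1: "card Q \<noteq> 1" if Q: "Q \<in> special_orbits" for Q
  proof
    assume "card Q = 1"
    obtain x where x: "Q = point_orbit H x" using Q by blast
    then obtain y where "point_orbit H x = {y}" using \<open>card Q = 1\<close> by (metis card_1_singletonE)
    then have "\<forall>h\<in>H. h x = y" "x = y" using self_mem_orbit[of x] by (auto simp: point_orbit_def)
    then show False using no_fix by blast
  qed
  have size_dvd: "\<exists>r\<ge>2. card Q * r = ?N" if "Q \<in> special_orbits" for Q
    using that card_orbit_stab special_iff_card by blast
  have "2 * card (special_points H) = (\<Sum>Q\<in>special_orbits. 2 * card Q)"
    by (simp add: card_special sum_distrib_left)
  also have "\<dots> \<le> (\<Sum>Q\<in>special_orbits. ?N)"
    by (rule sum_mono) (use special_orbit_card in auto)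
  finally have "2 * card (special_points H) \<le> ?k * ?N" by simp
  then have "?k * ?N < 4 * ?N" using class_equation by linarith
  then have "?k < 4" by simp
  moreover have "?k \<noteq> 0"
  proof
    assume "?k = 0"
    then show False using class_equation N by simp
  qed
  moreover have "?k \<noteq> 1"
  proof
    assume k: "?k = 1"
    then obtain Q where "special_orbits = {Q}" by (metis card_1_singletonE)
    then have "card (special_points H) = card Q" "Q \<in> special_orbits" using card_special by simp_all
    then have "card (special_points H) \<ge> 1" using size_pos by simp
    then show False using class_equation N unfolding k by linarith
  qed
  moreover have "?k \<noteq> 2"
  proof
    assume k: "?k = 2"
    then obtain A B where AB: "special_orbits = {A, B}" "A \<noteq> B" by (metis card_2_iff)
    then have "card A + card B = 2" using class_equation unfolding k by (simp add: card_special)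
    then show False using size_pos[of A] size_pos[of B] size_ne_1[of A] AB by auto
  qed
  ultimately have k: "?k = 3" by linarith
  then obtain A' B' C' where ABC': "special_orbits = {A', B', C'}" "A' \<noteq> B'" "B' \<noteq> C'" "A' \<noteq> C'"
    by (metis card_3_iff)
  obtain A B C where ABC: "special_orbits = {A, B, C}" "A \<noteq> B" "B \<noteq> C" "A \<noteq> C"
    and sorted: "card C \<le> card B" "card B \<le> card A"
  proof -
    consider "card C' \<le> card B' \<and> card B' \<le> card A'" | "card B' \<le> card C' \<and> card C' \<le> card A'"
      | "card C' \<le> card A' \<and> card A' \<le> card B'" | "card A' \<le> card C' \<and> card C' \<le> card B'"
      | "card A' \<le> card B' \<and> card B' \<le> card C'" | "card B' \<le> card A' \<and> card A' \<le> card C'"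
      by linarith
    then show ?thesis
    proof cases
      case 1 then show ?thesis using ABC' that[of A' B' C'] by blast
    next
      case 2 then show ?thesis using ABC' that[of A' C' B'] by blast
    next
      case 3 then show ?thesis using ABC' that[of B' A' C'] by blast
    next
      case 4 then show ?thesis using ABC' that[of B' C' A'] by blast
    next
      case 5 then show ?thesis using ABC' that[of C' B' A'] by blast
    next
      case 6 then show ?thesis using ABC' that[of C' A' B'] by blast
    qed
  qed
  have sum: "card A + card B + card C = ?N + 2"
    using class_equation ABC unfolding k by (simp add: card_special)
  obtain p q r where pqr: "p \<ge> 2" "card A * p = ?N" "q \<ge> 2" "card B * q = ?N" "r \<ge> 2" "card C * r = ?N"
    using size_dvd[of A] size_dvd[of B] size_dvd[of C] ABC(1) by auto
  obtain z where z: "C = point_orbit H z" using ABC(1) by blast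
  consider "card C = 2" | "?N = 12 \<and> card C = 4"
    | "?N = 24" "card A = 12" "card B = 8" "card C = 6"
    | "?N = 60" "card A = 30" "card B = 20" "card C = 12"
    using orbit_size_arithmetic[OF pqr(2,4,6,1,3,5) sum sorted] by blast
  then show ?thesis
  proof cases
    case 1 then show ?thesis using pair z by blast
  next
    case 2 then show ?thesis using tetrahedral z by blast
  next
    case 3 then show ?thesis using octahedral ABC by (auto simp: inj_on_def)
  next
    case 4 then show ?thesis using icosahedral ABC by (auto simp: inj_on_def)
  qed
qed

text \<open>The action on four points is faithful because a nontrivial element fixes only two of them; its
  image has index two in the symmetric group.\<close>

lemma iso_alt_group_4:
  assumes card: "card H = 12" "card (point_orbit H x) = 4"
  shows "comp_group H \<cong> alt_group 4"
proof -
  obtain F where F: "F \<in> hom (comp_group H) (sym_group 4)" "inj_on F H"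
  proof (rule faithful_action_embedding[of "point_orbit H x" 4 "\<lambda>h. h"])
    fix h assume h: "h \<in> H" "\<And>y. y \<in> point_orbit H x \<Longrightarrow> h y = y"
    show "h = id"
    proof (rule ccontr)
      assume "h \<noteq> id"
      then have "card (point_orbit H x) \<le> card {y. h y = y}"
        using h finite_fixed by (intro card_mono) auto
      then show False using two_fixed_points[OF h(1) \<open>h \<noteq> id\<close>] card by simp
    qed
  next
    fix h y assume "h \<in> H" "y \<in> point_orbit H x"
    then show "h y \<in> point_orbit H x" using orbit_image by blast
  qed (auto simp: card finite_orbit)
  show ?thesis by (rule iso_alt_group[OF F]) (simp_all add: card fact_numeral)
qed

lemma special_orbit_with_size:
  assumes "n \<in> card ` special_orbits"
  obtains x where "x \<in> special_points H" "card (point_orbit H x) = n"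
  using assms by auto

text \<open>The orbit of size 8 has stabilizers of order 3 and consists of the vertices of a cube; the group
  permutes its four diagonals. An element that preserves every diagonal is an involution, and if it is
  nontrivial it cannot fix a vertex, whose stabilizer has odd order. So two nontrivial elements of the
  kernel agree at a vertex and are equal. A unique nontrivial element of a normal subgroup is central,
  and its two fixed points form a union of orbits, of which none is that small.\<close>

lemma iso_sym_group_4:
  assumes N: "card H = 24" and sizes: "card ` special_orbits = {12, 8, 6}"
    and distinct: "inj_on card special_orbits"
  shows "comp_group H \<cong> sym_group 4"
proof -
  obtain x where x: "x \<in> special_points H" "card (point_orbit H x) = 8"
    using special_orbit_with_size[of 8] sizes by auto
  define Q where "Q = point_orbit H x"
  have Q_special: "y \<in> special_points H" if "y \<in> Q" for y
    using that special_orbit x by (simp add: Q_def)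
  have axis_Q: "axis y \<subseteq> Q" if y: "y \<in> Q" for y
  proof
    fix z assume z: "z \<in> axis y"
    then have "z \<in> special_points H" using axis_subset_special Q_special y by blast
    moreover have "card (point_orbit H z) = card (point_orbit H x)"
      using card_orbit_axis[OF z] orbit_eq y by (simp add: Q_def)
    ultimately have "point_orbit H z = point_orbit H x"
      using distinct x(1) by (auto simp: inj_on_def)
    then show "z \<in> Q" using self_mem_orbit[of z] by (simp add: Q_def)
  qed
  have image_Q: "h y \<in> Q" if "h \<in> H" "y \<in> Q" for h y
    using that orbit_image unfolding Q_def by blast
  have "card (axis ` Q) * 2 = card Q"
    by (rule card_blocks)
       (use finite_orbit axis_Q self_mem_axis card_axis Q_special axis_eq in \<open>auto simp: Q_def\<close>)
  then have card4: "card (axis ` Q) = 4" using x by (simp add: Q_def)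
  have inv_on_Q: "f \<circ> f = id" if f: "f \<in> H" "\<And>y. y \<in> Q \<Longrightarrow> f ` axis y = axis y" for f
  proof (rule ccontr)
    assume ne: "f \<circ> f \<noteq> id"
    have "f (f y) = y" if y: "y \<in> Q" for y
    proof -
      obtain u v where uv: "axis y = {u, v}" "u \<noteq> v"
        using card_axis[OF Q_special[OF y]] by (metis card_2_iff)
      then have "f ` {u, v} = {u, v}" using f(2)[OF y] by simp
      moreover have "f u \<noteq> f v" using uv(2) f(1) by (simp add: apply_eq_iff)
      ultimately have "f (f u) = u" "f (f v) = v" by (auto simp: doubleton_eq_iff)
      then show ?thesis using self_mem_axis[of y] uv by auto
    qed
    then have "card Q \<le> card {y. (f \<circ> f) y = y}"
      using finite_fixed[OF comp_mem[OF f(1) f(1)] ne] by (intro card_mono) auto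
    then show False using two_fixed_points[OF comp_mem[OF f(1) f(1)] ne] x by (simp add: Q_def)
  qed
  have no_fix: "f = id" if f: "f \<in> H" "\<And>y. y \<in> Q \<Longrightarrow> f ` axis y = axis y" "f x = x" for f
  proof (rule ccontr)
    assume ne: "f \<noteq> id"
    interpret S: finite_perm_group "point_stab H x" by (rule point_stab_group)
    have ff: "f \<circ> f = id" using inv_on_Q f by blast
    have "finite_perm_group {id, f}"
    proof
      fix g assume "g \<in> {id, f}"
      then show "\<exists>h\<in>{id, f}. h \<circ> g = id \<and> g \<circ> h = id" using ff by auto
    qed (use ff in auto)
    moreover have "{id, f} \<subseteq> point_stab H x" using f id_mem by (auto simp: point_stab_def)
    ultimately have "card {id, f} dvd card (point_stab H x)" by (rule S.card_dvd)
    moreover have "card {id, f} = 2" using ne by auto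
    moreover have "card (point_stab H x) = 3" using card_orbit_stab[of x] x N by simp
    ultimately show False by simp
  qed
  have faithful: "f = id" if f: "f \<in> H" "\<And>y. y \<in> Q \<Longrightarrow> f ` axis y = axis y" for f
  proof (rule ccontr)
    assume ne: "f \<noteq> id"
    have xQ: "x \<in> Q" using self_mem_orbit by (simp add: Q_def)
    obtain x' where x': "axis x = {x, x'}" "x \<noteq> x'"
      using card_axis[OF x(1)] self_mem_axis[of x] by (metis card_2_iff insertE insert_commute singletonD)
    have swap: "g x = x'" if "g \<in> H" "\<And>y. y \<in> Q \<Longrightarrow> g ` axis y = axis y" "g \<noteq> id" for g
    proof -
      have "g x \<in> axis x" using that(2)[OF xQ] self_mem_axis by blast
      moreover have "g x \<noteq> x" using no_fix[OF that(1,2)] that(3) by blast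
      ultimately show ?thesis using x' by simp
    qed
    have unique: "g = f" if g: "g \<in> H" "\<And>y. y \<in> Q \<Longrightarrow> g ` axis y = axis y" "g \<noteq> id" for g
    proof -
      have "f \<circ> g = id"
      proof (rule no_fix)
        show "(f \<circ> g) ` axis y = axis y" if "y \<in> Q" for y
          using f(2)[OF that] g(2)[OF that] by (metis image_comp)
        have "f x' = x" using inv_on_Q[OF f] swap[OF f ne] by (metis comp_apply id_apply)
        then show "(f \<circ> g) x = x" using swap[OF g] by simp
      qed (use f g comp_mem in auto)
      then have "f \<circ> (f \<circ> g) = f" by simp
      then show ?thesis using inv_on_Q[OF f] by (metis comp_assoc id_comp)
    qed
    \<comment> \<open>the conjugates of \<open>f\<close> lie in the kernel too, so they equal \<open>f\<close>\<close>
    have central: "h (f u) = f (h u)" if h: "h \<in> H" for h u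
    proof -
      have "h \<circ> f \<circ> inv' h = f"
      proof (rule unique)
        show "h \<circ> f \<circ> inv' h \<in> H" using h f comp_mem inv_mem by simp
        show "h \<circ> f \<circ> inv' h \<noteq> id"
        proof
          assume "h \<circ> f \<circ> inv' h = id"
          then have "(h \<circ> f \<circ> inv' h) (h v) = h v" for v by simp
          then have "f v = v" for v using h by (simp add: apply_eq_iff)
          then show False using ne by auto
        qed
        show "(h \<circ> f \<circ> inv' h) ` axis y = axis y" if y: "y \<in> Q" for y
        proof -
          have "(h \<circ> f \<circ> inv' h) ` axis y = h ` f ` inv' h ` axis y" by (simp add: image_comp)
          also have "\<dots> = h ` f ` axis (inv' h y)" using image_axis[OF inv_mem[OF h]] by simp
          also have "f ` axis (inv' h y) = axis (inv' h y)" using f(2) image_Q[OF inv_mem[OF h] y] by simp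
          also have "h ` axis (inv' h y) = axis y" using image_axis[OF h] h by simp
          finally show ?thesis .
        qed
      qed
      then have "(h \<circ> f \<circ> inv' h) (h u) = f (h u)" by simp
      then show ?thesis using h by simp
    qed
    have "card {u. f u = u} = 2" using two_fixed_points f(1) ne by blast
    then have "{u. f u = u} \<noteq> {}" by (metis card.empty zero_neq_numeral)
    then obtain u where u: "f u = u" by auto
    then have "u \<in> special_points H" using f(1) ne by (auto simp: special_iff)
    then have "card (point_orbit H u) \<in> {12, 8, 6}" using sizes by blast
    moreover have "f (h u) = h u" if "h \<in> H" for h
      using central[OF that, of u] u by simp
    then have "card (point_orbit H u) \<le> card {u. f u = u}"
      using finite_fixed[OF f(1) ne] by (intro card_mono) (auto simp: point_orbit_def)
    ultimately show False using two_fixed_points[OF f(1) ne] by auto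
  qed
  obtain F where F: "F \<in> hom (comp_group H) (sym_group 4)" "inj_on F H"
  proof (rule faithful_action_embedding[of "axis ` Q" 4 "\<lambda>h B. h ` B"])
    fix h B assume "h \<in> H" "B \<in> axis ` Q"
    then show "h ` B \<in> axis ` Q" using image_axis image_Q by auto
  next
    fix h assume "h \<in> H" "\<And>B. B \<in> axis ` Q \<Longrightarrow> h ` B = B"
    then show "h = id" using faithful by blast
  qed (use card4 finite_orbit in \<open>auto simp: Q_def image_comp\<close>)
  show ?thesis by (rule iso_sym_group[OF F]) (simp add: N fact_numeral)
qed

text \<open>The orbit of size 30 has stabilizers of order 2 and consists of the edge midpoints of an
  icosahedron. The stabilizer of an axis through two of them has order 4 and exponent 2, and its three
  involutions have three disjoint axes, the diagonals of an octahedron. These octahedra are blocks of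
  size 6, so there are five of them and each has a stabilizer of order 12. The kernel of the action
  on the octahedra thus has at most 12 elements. If it contained a nontrivial element it would
  contain, by normality and because point stabilizers have prime order, the stabilizers of a
  whole special orbit, and hence more than 12 elements.\<close>

lemma iso_alt_group_5:
  assumes N: "card H = 60" and sizes: "card ` special_orbits = {30, 20, 12}"
    and distinct: "inj_on card special_orbits"
  shows "comp_group H \<cong> alt_group 5"
proof -
  obtain x where x: "x \<in> special_points H" "card (point_orbit H x) = 30"
    using special_orbit_with_size[of 30] sizes by auto
  define Q where "Q = point_orbit H x"
  have xQ: "x \<in> Q" using self_mem_orbit by (simp add: Q_def)
  have Q_special: "y \<in> special_points H" if "y \<in> Q" for y
    using that special_orbit x by (simp add: Q_def)
  have image_Q: "h y \<in> Q" if "h \<in> H" "y \<in> Q" for h y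
    using that orbit_image unfolding Q_def by blast
  have Q_I: "z \<in> Q" if z: "z \<in> special_points H" "card (point_orbit H z) = 30" for z
  proof -
    have "point_orbit H z = point_orbit H x"
      using distinct x z by (auto simp: inj_on_def)
    then show "z \<in> Q" using self_mem_orbit[of z] by (simp add: Q_def)
  qed
  have orbit_Q: "point_orbit H y = Q" if "y \<in> Q" for y
    using that orbit_eq by (simp add: Q_def)
  have stab_Q: "card (point_stab H y) = 2" if "y \<in> Q" for y
    using card_orbit_stab[of y] orbit_Q[OF that] x N by (simp add: Q_def)
  have axis_Q: "axis y \<subseteq> Q" if y: "y \<in> Q" for y
  proof
    fix z assume z: "z \<in> axis y"
    then have "z \<in> special_points H" using axis_subset_special Q_special y by blast
    then show "z \<in> Q" using Q_I card_orbit_axis[OF z] orbit_Q[OF y] x by (simp add: Q_def)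
  qed
  have stab_cases: "card (point_stab H z) \<in> {2, 3, 5} \<and> card (point_orbit H z) \<le> 30"
    if "z \<in> special_points H" for z
  proof -
    have "card (point_orbit H z) \<in> {30, 20, 12}" using that sizes by blast
    then show ?thesis using card_orbit_stab[of z] N by auto
  qed
  have involution_Q: "z \<in> Q" if s: "s \<in> H" "s \<noteq> id" "s \<circ> s = id" "s z = z" for s z
  proof -
    interpret S: finite_perm_group "point_stab H z" by (rule point_stab_group)
    have "finite_perm_group {id, s}"
    proof
      fix g assume "g \<in> {id, s}"
      then show "\<exists>h\<in>{id, s}. h \<circ> g = id \<and> g \<circ> h = id" using s by auto
    qed (use s in auto)
    moreover have "{id, s} \<subseteq> point_stab H z" using s id_mem by (auto simp: point_stab_def)
    ultimately have "card {id, s} dvd card (point_stab H z)" by (rule S.card_dvd)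
    moreover have "card {id, s} = 2" using s by auto
    ultimately have "2 dvd card (point_stab H z)" by (simp only:)
    moreover have z: "z \<in> special_points H" using s by (auto simp: special_iff)
    ultimately have "card (point_stab H z) = 2" using stab_cases[OF z] by auto
    then show ?thesis using Q_I[OF z] card_orbit_stab[of z] N by simp
  qed
  \<comment> \<open>the Klein four-group that preserves the axis through \<open>y\<close>\<close>
  define A where "A = (\<lambda>y. {h \<in> H. h ` axis y = axis y})"
  have card_A: "card (A y) = 4" if y: "y \<in> Q" for y
  proof -
    have "(\<lambda>h. h ` axis y) ` H = axis ` Q"
      using image_axis orbit_Q[OF y] by (auto simp: point_orbit_def)
    moreover have "card (axis ` Q) * 2 = card Q"
      by (rule card_blocks)
         (use finite_orbit axis_Q self_mem_axis card_axis Q_special axis_eq in \<open>auto simp: Q_def\<close>)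
    ultimately show ?thesis
      using card_orbit_image_stab[of "axis y"] N x by (simp add: Q_def A_def)
  qed
  have A_involution: "s \<circ> s = id" if y: "y \<in> Q" and s: "s \<in> A y" for y s
  proof (cases "s y = y")
    case True
    obtain p q where "point_stab H y = {p, q}" using stab_Q[OF y] by (metis card_2_iff)
    moreover have "id \<in> point_stab H y" using id_mem by (simp add: point_stab_def)
    ultimately obtain t where t: "point_stab H y = {id, t}" by (metis insert_commute insertE singletonD)
    interpret S: finite_perm_group "point_stab H y" by (rule point_stab_group)
    have "s \<in> point_stab H y" using True s by (simp add: point_stab_def A_def)
    then have "s \<circ> s \<in> {id, s}" using S.comp_mem[of s s] t by auto
    moreover have "s \<circ> s \<noteq> s" if "s \<noteq> id"
    proof
      assume "s \<circ> s = s"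
      then have "s (s v) = s v" for v by (metis comp_apply)
      then have "s v = v" for v using s by (simp add: A_def apply_eq_iff)
      then show False using that by auto
    qed
    ultimately show ?thesis by (cases "s = id") auto
  next
    case False
    have sH: "s \<in> H" "s ` axis y = axis y" using s by (auto simp: A_def)
    obtain u v where uv: "axis y = {u, v}" "u \<noteq> v"
      using card_axis[OF Q_special[OF y]] by (metis card_2_iff)
    then have "s ` {u, v} = {u, v}" using sH by simp
    moreover have "s u \<noteq> s v" using uv(2) sH by (simp add: apply_eq_iff)
    moreover have "y \<in> {u, v}" using self_mem_axis[of y] uv by simp
    ultimately have "s u = v" "s v = u" using False by (auto simp: doubleton_eq_iff)
    then show ?thesis using swap_imp_involution sH uv by blast
  qed
  have A_group: "finite_perm_group (A y)" for y unfolding A_def by (rule set_stab_group)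
  \<comment> \<open>a group of exponent 2 is commutative\<close>
  have A_commute: "s (t v) = t (s v)" if y: "y \<in> Q" and st: "s \<in> A y" "t \<in> A y" for y s t v
  proof -
    have "(s \<circ> t) \<circ> (s \<circ> t) = id"
      using A_involution[OF y] finite_perm_group.comp_mem[OF A_group] st by blast
    then have "s (t (s (t (t (s v))))) = t (s v)" by (metis comp_apply id_apply)
    moreover have "t (t w) = w" "s (s w) = w" for w
      using A_involution[OF y st(1)] A_involution[OF y st(2)] by (metis comp_apply id_apply)+
    ultimately show ?thesis by simp
  qed
  \<comment> \<open>the vertices of the octahedron with \<open>y\<close> as a vertex\<close>
  define oct where "oct = (\<lambda>y. \<Union>s\<in>A y - {id}. {z. s z = z})"
  have oct_Q: "oct y \<subseteq> Q" if "y \<in> Q" for y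
    using involution_Q A_involution[OF that] by (auto simp: oct_def A_def)
  have card_oct: "card (oct y) = 6" if y: "y \<in> Q" for y
  proof -
    have fin: "finite (A y)" using finite_perm_group.finite_H[OF A_group] .
    have "card (oct y) = (\<Sum>s\<in>A y - {id}. card {z. s z = z})"
      unfolding oct_def
    proof (rule card_UN_disjoint)
      show "\<forall>s\<in>A y - {id}. \<forall>t\<in>A y - {id}. s \<noteq> t \<longrightarrow> {z. s z = z} \<inter> {z. t z = z} = {}"
      proof (intro ballI impI, rule ccontr)
        fix s t assume st: "s \<in> A y - {id}" "t \<in> A y - {id}" "s \<noteq> t"
          and "{z. s z = z} \<inter> {z. t z = z} \<noteq> {}"
        then obtain z where z: "s z = z" "t z = z" by auto
        have "z \<in> Q" using involution_Q A_involution[OF y] st z by (auto simp: A_def)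
        moreover have "card {id, s, t} \<le> card (point_stab H z)"
          using st z id_mem finite_H by (intro card_mono) (auto simp: point_stab_def A_def)
        moreover have "card {id, s, t} = 3" using st by (auto simp: card_insert_if)
        ultimately show False using stab_Q by simp
      qed
    qed (use fin finite_fixed in \<open>auto simp: A_def\<close>)
    also have "\<dots> = (\<Sum>s\<in>A y - {id}. 2)"
      by (rule sum.cong) (auto simp: two_fixed_points A_def)
    also have "\<dots> = 6"
      using card_A[OF y] finite_perm_group.id_mem[OF A_group] fin by simp
    finally show ?thesis .
  qed
  have self_oct: "y \<in> oct y" if y: "y \<in> Q" for y
  proof -
    obtain s where s: "s \<in> H" "s \<noteq> id" "s y = y" using Q_special[OF y] by (auto simp: special_iff)
    then have "s \<in> A y" using image_axis by (simp add: A_def)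
    then show ?thesis using s by (auto simp: oct_def)
  qed
  have oct_eq: "oct z = oct y" if y: "y \<in> Q" and z: "z \<in> oct y" for y z
  proof -
    obtain s where s: "s \<in> A y" "s \<noteq> id" "s z = z" using z by (auto simp: oct_def)
    have "A y \<subseteq> A z"
    proof
      fix t assume t: "t \<in> A y"
      have sH: "s \<in> H" using s by (simp add: A_def)
      have "s (t z) = t z" using A_commute[OF y s(1) t, of z] s by simp
      then have "t z \<in> axis z" using axis_eq_fixed[OF sH s(2,3)] by simp
      then have "axis (t z) = axis z" by (rule axis_eq)
      then show "t \<in> A z" using t image_axis by (simp add: A_def)
    qed
    moreover have "card (A y) = card (A z)" using card_A y z oct_Q by auto
    ultimately have "A y = A z"
      using finite_perm_group.finite_H[OF A_group] by (intro card_subset_eq) auto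
    then show ?thesis by (simp add: oct_def)
  qed
  have card5: "card (oct ` Q) = 5"
  proof -
    have "card (oct ` Q) * 6 = card Q"
    proof (rule card_blocks)
      show "finite Q" using finite_orbit by (simp add: Q_def)
      show "y \<in> oct y \<and> oct y \<subseteq> Q \<and> card (oct y) = 6" if "y \<in> Q" for y
        using self_oct oct_Q card_oct that by simp
    qed (rule oct_eq)
    then show ?thesis using x by (simp add: Q_def)
  qed
  have image_oct: "h ` oct y = oct (h y)" if h: "h \<in> H" and y: "y \<in> Q" for h y
  proof (rule card_subset_eq)
    show "finite (oct (h y))" using oct_Q[OF image_Q[OF h y]] finite_orbit finite_subset by (auto simp: Q_def)
    have "inj_on h (oct y)" using apply_eq_iff[OF h] by (auto intro: inj_onI)
    then show "card (h ` oct y) = card (oct (h y))"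
      using card_oct[OF y] card_oct[OF image_Q[OF h y]] by (simp add: card_image)
    show "h ` oct y \<subseteq> oct (h y)"
    proof
      fix w assume "w \<in> h ` oct y"
      then obtain v s where v: "w = h v" "s \<in> A y" "s \<noteq> id" "s v = v" by (auto simp: oct_def)
      have sH: "s \<in> H" "s ` axis y = axis y" using v by (auto simp: A_def)
      define s' where "s' = h \<circ> s \<circ> inv' h"
      have s'H: "s' \<in> H" using h sH comp_mem inv_mem by (simp add: s'_def)
      have "s' ` axis (h y) = axis (s' (h y))" by (rule image_axis[OF s'H])
      also have "s' (h y) = h (s y)" using h by (simp add: s'_def)
      also have "axis (h (s y)) = h ` s ` axis y" using image_axis h sH(1) by simp
      also have "\<dots> = axis (h y)" using image_axis h sH(2) by simp
      finally have "s' \<in> A (h y)" using s'H by (simp add: A_def)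
      moreover have "s' w = w" using v h by (simp add: s'_def)
      moreover have "s' \<noteq> id"
      proof
        assume "s' = id"
        then have "s' (h u) = h u" for u by simp
        then have "s u = u" for u using h by (simp add: s'_def apply_eq_iff)
        then show False using v by auto
      qed
      ultimately show "w \<in> oct (h y)" by (auto simp: oct_def)
    qed
  qed
  \<comment> \<open>the kernel of the action on the five octahedra\<close>
  define K where "K = {h \<in> H. \<forall>y\<in>Q. h ` oct y = oct y}"
  have K_group: "finite_perm_group K"
  proof (rule subgroup_group)
    fix f g assume fg: "f \<in> K" "g \<in> K"
    have "(f \<circ> g) ` oct y = oct y" if "y \<in> Q" for y
    proof -
      have "(f \<circ> g) ` oct y = f ` g ` oct y" by (simp add: image_comp)
      also have "\<dots> = oct y" using fg that by (simp add: K_def)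
      finally show ?thesis .
    qed
    then show "f \<circ> g \<in> K" using fg comp_mem by (simp add: K_def)
  next
    fix f assume f: "f \<in> K"
    have "inv' f ` oct y = oct y" if "y \<in> Q" for y
    proof -
      have "inv' f ` oct y = inv' f ` f ` oct y" using f that by (simp add: K_def)
      also have "\<dots> = (\<lambda>x. inv' f (f x)) ` oct y" by (rule image_image)
      finally show ?thesis using f by (simp add: K_def)
    qed
    then show "inv' f \<in> K" using f inv_mem by (simp add: K_def)
  qed (auto simp: K_def id_mem)
  interpret K: two_point_group K
    by (rule two_point_subgroup[OF K_group]) (auto simp: K_def)
  have K_normal: "h \<circ> f \<circ> inv' h \<in> K" if h: "h \<in> H" and f: "f \<in> K" for h f
  proof -
    have "(h \<circ> f \<circ> inv' h) ` oct y = oct y" if y: "y \<in> Q" for y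
    proof -
      have "(h \<circ> f \<circ> inv' h) ` oct y = h ` f ` inv' h ` oct y" by (simp add: image_comp)
      also have "\<dots> = h ` f ` oct (inv' h y)" using image_oct[OF inv_mem[OF h] y] by simp
      also have "f ` oct (inv' h y) = oct (inv' h y)" using f image_Q[OF inv_mem[OF h] y] by (simp add: K_def)
      also have "h ` oct (inv' h y) = oct y" using image_oct[OF h image_Q[OF inv_mem[OF h] y]] h by simp
      finally show ?thesis .
    qed
    moreover have "h \<circ> f \<circ> inv' h \<in> H" using h f comp_mem inv_mem by (simp add: K_def)
    ultimately show ?thesis by (simp add: K_def)
  qed
  have card_K: "card K \<le> 12"
  proof -
    have "(\<lambda>h. h ` oct x) ` H = oct ` Q"
      using image_oct[OF _ xQ] by (auto simp: point_orbit_def Q_def)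
    then have "card {h \<in> H. h ` oct x = oct x} = 12"
      using card_orbit_image_stab[of "oct x"] N card5 by simp
    moreover have "card K \<le> card {h \<in> H. h ` oct x = oct x}"
      using finite_H xQ by (intro card_mono) (auto simp: K_def)
    ultimately show ?thesis by simp
  qed
  have faithful: "f = id" if f: "f \<in> K" for f
  proof (rule ccontr)
    assume ne: "f \<noteq> id"
    have fH: "f \<in> H" using f by (simp add: K_def)
    have "card {u. f u = u} = 2" using two_fixed_points fH ne by blast
    then have "{u. f u = u} \<noteq> {}" by (metis card.empty zero_neq_numeral)
    then obtain u where u: "f u = u" by auto
    have u_special: "u \<in> special_points H" using fH ne u by (auto simp: special_iff)
    have stab_K: "point_stab K w = point_stab H w \<and> w \<in> special_points K" if w: "w \<in> point_orbit H u" for w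
    proof -
      obtain h where h: "h \<in> H" "w = h u" using w by (auto simp: point_orbit_def)
      define g where "g = h \<circ> f \<circ> inv' h"
      have g: "g \<in> K" "g w = w" using K_normal[OF h(1) f] h u by (simp_all add: g_def)
      have "g \<noteq> id"
      proof
        assume "g = id"
        then have "g (h v) = h v" for v by simp
        then have "f v = v" for v using h by (simp add: g_def apply_eq_iff)
        then show False using ne by auto
      qed
      then have wK: "w \<in> special_points K" using g by (auto simp: K.special_iff)
      interpret S: finite_perm_group "point_stab H w" by (rule point_stab_group)
      have sub: "point_stab K w \<subseteq> point_stab H w" by (auto simp: point_stab_def K_def)
      have dvd: "card (point_stab K w) dvd card (point_stab H w)"
        by (rule S.card_dvd[OF K.point_stab_group sub])
      have H_cases: "card (point_stab H w) \<in> {2, 3, 5}"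
        using stab_cases[OF special_orbit[OF u_special w]] by blast
      then have "card (point_stab K w) \<le> 5" using dvd_imp_le[OF dvd] by auto
      moreover have "card (point_stab K w) \<ge> 2" using wK K.special_iff_card by blast
      ultimately have "card (point_stab K w) \<in> {2, 3, 4, 5}" by auto
      then have "card (point_stab K w) = card (point_stab H w)" using dvd H_cases by auto
      then show ?thesis using wK sub card_subset_eq[OF S.finite_H] by blast
    qed
    \<comment> \<open>the double count for \<open>K\<close>, restricted to the orbit of \<open>u\<close>: that orbit contributes \<open>60 - card (point_orbit H u)\<close>\<close>
    have "30 \<le> (\<Sum>w\<in>point_orbit H u. card (point_stab H u) - 1)"
      using stab_cases[OF u_special] card_orbit_stab[of u] N by (auto simp: diff_mult_distrib2)
    also have "\<dots> = (\<Sum>w\<in>point_orbit H u. card (point_stab K w) - 1)"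
      by (rule sum.cong) (simp_all add: stab_K card_stab_orbit)
    also have "\<dots> \<le> (\<Sum>w\<in>special_points K. card (point_stab K w) - 1)"
      using stab_K by (intro sum_mono2 K.finite_special) auto
    also have "\<dots> = 2 * (card K - 1)" by (rule K.sum_stab_special)
    finally show False using card_K by simp
  qed
  obtain F where F: "F \<in> hom (comp_group H) (sym_group 5)" "inj_on F H"
  proof (rule faithful_action_embedding[of "oct ` Q" 5 "\<lambda>h B. h ` B"])
    fix h B assume "h \<in> H" "B \<in> oct ` Q"
    then show "h ` B \<in> oct ` Q" using image_oct image_Q by auto
  next
    fix h assume "h \<in> H" "\<And>B. B \<in> oct ` Q \<Longrightarrow> h ` B = B"
    then show "h = id" using faithful by (auto simp: K_def)
  qed (use card5 finite_orbit in \<open>auto simp: Q_def image_comp\<close>)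
  show ?thesis by (rule iso_alt_group[OF F]) (simp_all add: N fact_numeral)
qed

theorem classification:
  obtains (fixed_point) x where "\<And>h. h \<in> H \<Longrightarrow> h x = x"
    | (invariant_pair) x y where "x \<noteq> y" "\<And>h. h \<in> H \<Longrightarrow> h ` {x, y} = {x, y}"
    | (A4) "comp_group H \<cong> alt_group 4"
    | (S4) "comp_group H \<cong> sym_group 4"
    | (A5) "comp_group H \<cong> alt_group 5"
proof (cases "\<exists>x. \<forall>h\<in>H. h x = x")
  case True
  then show ?thesis using fixed_point by blast
next
  case False
  then show ?thesis
  proof (cases rule: orbit_type_cases)
    case (pair x)
    then obtain u v where "point_orbit H x = {u, v}" "u \<noteq> v" by (metis card_2_iff)
    then show ?thesis using invariant_pair[of u v] orbit_image[of _ x] by simp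
  next
    case (tetrahedral x)
    then show ?thesis using A4 iso_alt_group_4 by blast
  next
    case octahedral
    then show ?thesis using S4 iso_sym_group_4 by blast
  next
    case icosahedral
    then show ?thesis using A5 iso_alt_group_5 by blast
  qed
qed

end

section \<open>Moebius transformations and their fixed points\<close>

lemma moebius_None: "moebius a b c d None = (if c = 0 then None else Some (a / c))"
  by (simp add: moebius_def)

lemma moebius_Some:
  "moebius a b c d (Some z) = (if c * z + d = 0 then None else Some ((a * z + b) / (c * z + d)))"
  by (simp add: moebius_def)

lemma moebius_comp:
  assumes det: "a * d - b * c \<noteq> 0" and det': "a' * d' - b' * c' \<noteq> 0"
  shows "moebius a b c d \<circ> moebius a' b' c' d'
    = moebius (a * a' + b * c') (a * b' + b * d') (c * a' + d * c') (c * b' + d * d')"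
proof
  fix w
  show "(moebius a b c d \<circ> moebius a' b' c' d') w
    = moebius (a * a' + b * c') (a * b' + b * d') (c * a' + d * c') (c * b' + d * d') w"
  proof (cases w)
    case None
    show ?thesis
    proof (cases "c' = 0")
      case True
      then have "a' \<noteq> 0" using det' by auto
      then show ?thesis using True None by (simp add: moebius_None)
    next
      case False
      then have "c * (a' / c') + d = (c * a' + d * c') / c'" "a * (a' / c') + b = (a * a' + b * c') / c'"
        by (simp_all add: field_simps)
      then show ?thesis using False None by (simp add: moebius_None moebius_Some)
    qed
  next
    case (Some z)
    define N D where "N = a' * z + b'" and "D = c' * z + d'"
    have num: "(a * a' + b * c') * z + (a * b' + b * d') = a * N + b * D"
      and den: "(c * a' + d * c') * z + (c * b' + d * d') = c * N + d * D"
      by (simp_all add: N_def D_def algebra_simps)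
    show ?thesis
    proof (cases "D = 0")
      case True
      have "N \<noteq> 0"
      proof
        assume "N = 0"
        moreover have "a' * D - c' * N = a' * d' - b' * c'" by (simp add: N_def D_def algebra_simps)
        ultimately show False using True det' by simp
      qed
      then show ?thesis
        using True Some num den by (simp add: moebius_None moebius_Some flip: N_def D_def)
    next
      case False
      then have "c * (N / D) + d = (c * N + d * D) / D" "a * (N / D) + b = (a * N + b * D) / D"
        by (simp_all add: field_simps)
      then show ?thesis
        using False Some num den by (simp add: moebius_Some flip: N_def D_def)
    qed
  qed
qed

lemma moebius_scalar: "k \<noteq> 0 \<Longrightarrow> moebius k 0 0 k = id"
  by (auto simp: moebius_def fun_eq_iff split: option.splits)

lemma sphere_fun_eqI: "f None = g None \<Longrightarrow> (\<And>z. f (Some z) = g (Some z)) \<Longrightarrow> f = (g :: sphere \<Rightarrow> sphere)"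
  by (metis ext not_Some_eq)

lemma moebius_scale: "k \<noteq> 0 \<Longrightarrow> moebius (k * a) (k * b) (k * c) (k * d) = moebius a b c d"
proof (rule sphere_fun_eqI)
  assume k: "k \<noteq> 0"
  show "moebius (k * a) (k * b) (k * c) (k * d) None = moebius a b c d None"
    using k by (simp add: moebius_None)
  fix z
  have "k * c * z + k * d = k * (c * z + d)" "k * a * z + k * b = k * (a * z + b)"
    by (simp_all add: algebra_simps)
  then show "moebius (k * a) (k * b) (k * c) (k * d) (Some z) = moebius a b c d (Some z)"
    using k by (simp add: moebius_Some)
qed

abbreviation moebius_maps :: "(sphere \<Rightarrow> sphere) set" where
  "moebius_maps \<equiv> carrier moebius_group"

lemma moebius_maps_iff: "f \<in> moebius_maps \<longleftrightarrow> (\<exists>a b c d. f = moebius a b c d \<and> a * d - b * c \<noteq> 0)"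
  by (auto simp: moebius_group_def)

lemma moebius_mem: "a * d - b * c \<noteq> 0 \<Longrightarrow> moebius a b c d \<in> moebius_maps"
  by (auto simp: moebius_maps_iff)

lemma mult_moebius_group [simp]: "monoid.mult moebius_group = (\<circ>)"
  and one_moebius_group [simp]: "one moebius_group = id"
  by (simp_all add: moebius_group_def)

lemma id_mem_moebius: "id \<in> moebius_maps"
  using moebius_mem[of 1 1 0 0] moebius_scalar[of 1] by simp

lemma comp_mem_moebius: "f \<in> moebius_maps \<Longrightarrow> g \<in> moebius_maps \<Longrightarrow> f \<circ> g \<in> moebius_maps"
proof -
  assume "f \<in> moebius_maps" "g \<in> moebius_maps"
  then obtain a b c d a' b' c' d' where fg: "f = moebius a b c d" "a * d - b * c \<noteq> 0"
    "g = moebius a' b' c' d'" "a' * d' - b' * c' \<noteq> 0"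
    unfolding moebius_maps_iff by blast
  have "(a * a' + b * c') * (c * b' + d * d') - (a * b' + b * d') * (c * a' + d * c')
      = (a * d - b * c) * (a' * d' - b' * c')" by (simp add: algebra_simps)
  then show ?thesis
    using fg moebius_comp[OF fg(2,4)] moebius_mem by (metis mult_eq_0_iff)
qed

lemma inverse_moebius:
  assumes "f \<in> moebius_maps"
  obtains g where "g \<in> moebius_maps" "g \<circ> f = id" "f \<circ> g = id"
proof -
  obtain a b c d where f: "f = moebius a b c d" "a * d - b * c \<noteq> 0"
    using assms unfolding moebius_maps_iff by blast
  have det: "d * a - (- b) * (- c) \<noteq> 0" using f(2) by (simp add: algebra_simps)
  show ?thesis
  proof (rule that)
    show "moebius d (- b) (- c) a \<in> moebius_maps" using det by (rule moebius_mem)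
    show "moebius d (- b) (- c) a \<circ> f = id" "f \<circ> moebius d (- b) (- c) a = id"
      unfolding f(1) moebius_comp[OF f(2) det] moebius_comp[OF det f(2)]
      using moebius_scalar[of "a * d - b * c"] f(2) by (simp_all add: algebra_simps)
  qed
qed

lemma bij_moebius: "f \<in> moebius_maps \<Longrightarrow> bij f"
  using inverse_moebius o_bij by metis

lemma inv_mem_moebius: "f \<in> moebius_maps \<Longrightarrow> inv' f \<in> moebius_maps"
  by (metis inverse_moebius inv_unique_comp)

lemma inv_moebius_apply [simp]:
  "f \<in> moebius_maps \<Longrightarrow> inv' f (f x) = x" "f \<in> moebius_maps \<Longrightarrow> f (inv' f x) = x"
  using bij_moebius by (auto simp: bij_is_inj bij_is_surj surj_f_inv_f)

lemma group_moebius: "group moebius_group"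
proof (rule groupI)
  fix f assume "f \<in> moebius_maps"
  then obtain g where "g \<in> moebius_maps" "g \<circ> f = id" by (rule inverse_moebius)
  then show "\<exists>g\<in>moebius_maps. g \<otimes>\<^bsub>moebius_group\<^esub> f = \<one>\<^bsub>moebius_group\<^esub>" by auto
qed (simp_all add: id_mem_moebius comp_mem_moebius comp_assoc)

lemma affine_form:
  assumes "f \<in> moebius_maps" "f None = None"
  obtains a b where "a \<noteq> 0" "\<And>z. f (Some z) = Some (a * z + b)"
proof -
  obtain a b c d where f: "f = moebius a b c d" "a * d - b * c \<noteq> 0"
    using assms(1) unfolding moebius_maps_iff by blast
  then have "c = 0" using assms(2) by (simp add: moebius_None split: if_splits)
  then show ?thesis using f that[of "a / d" "b / d"] by (auto simp: moebius_Some add_divide_distrib)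
qed

lemma moebius_to_infinity: "\<exists>k\<in>moebius_maps. k x = None"
proof (cases x)
  case None
  then show ?thesis using id_mem_moebius by (intro bexI[of _ id]) auto
next
  case (Some z)
  then show ?thesis
    using moebius_mem[of 0 "- z" 1 1] by (intro bexI[of _ "moebius 0 1 1 (- z)"]) (auto simp: moebius_Some)
qed

text \<open>A fixed point in the finite plane is a root of \<open>c z\<^sup>2 + (d - a) z - b\<close>.\<close>

lemma moebius_has_fixed_point: "f \<in> moebius_maps \<Longrightarrow> \<exists>x. f x = x"
proof -
  assume "f \<in> moebius_maps"
  then obtain a b c d where f: "f = moebius a b c d" "a * d - b * c \<noteq> 0"
    unfolding moebius_maps_iff by blast
  show ?thesis
  proof (cases "c = 0")
    case True
    then show ?thesis using f by (intro exI[of _ None]) (simp add: moebius_None)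
  next
    case False
    define s where "s = csqrt ((a - d)\<^sup>2 + 4 * b * c)"
    define z where "z = (a - d + s) / (2 * c)"
    have s2: "s\<^sup>2 = (a - d)\<^sup>2 + 4 * b * c" by (simp add: s_def)
    have cz: "2 * (c * z) = a - d + s" using False by (simp add: z_def)
    have "4 * c * (z * (c * z + d) - (a * z + b)) = (2 * (c * z))\<^sup>2 - 2 * (a - d) * (2 * (c * z)) - 4 * b * c"
      by (simp add: power2_eq_square algebra_simps)
    also have "\<dots> = s\<^sup>2 - ((a - d)\<^sup>2 + 4 * b * c)"
      unfolding cz by (simp add: power2_eq_square algebra_simps)
    finally have eq: "z * (c * z + d) = a * z + b" using False s2 by simp
    have "c * z + d \<noteq> 0"
    proof
      assume 0: "c * z + d = 0"
      then have "a * z + b = 0" using eq by simp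
      then have "a * (c * z + d) - c * (a * z + b) = 0" using 0 by simp
      then show False using f(2) by (simp add: algebra_simps)
    qed
    then have "f (Some z) = Some z" using eq f by (simp add: moebius_Some field_simps)
    then show ?thesis ..
  qed
qed

text \<open>Conjugating a fixed point to \<open>\<infinity>\<close> makes the map affine, \<open>z \<mapsto> a z + b\<close>. For \<open>a \<noteq> 1\<close> there
  is exactly one finite fixed point; for \<open>a = 1\<close> it is a translation, which has none and whose powers
  are pairwise distinct.\<close>

lemma moebius_fixed_points:
  assumes f: "f \<in> moebius_maps" "f \<noteq> id"
  obtains x y where "{z. f z = z} = {x, y}" "x = y \<Longrightarrow> inj (\<lambda>n::nat. f ^^ n)"
proof -
  obtain x where x: "f x = x" using moebius_has_fixed_point f by blast
  obtain k where k: "k \<in> moebius_maps" "k x = None" using moebius_to_infinity by blast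
  define g where "g = k \<circ> f \<circ> inv' k"
  have kf: "k (f w) = g (k w)" for w using k by (simp add: g_def)
  have k_eq: "k v = k w \<longleftrightarrow> v = w" for v w using bij_moebius[OF k(1)] by (meson bij_is_inj inj_eq)
  have gN: "g None = None" using kf[of x] x k by simp
  have gM: "g \<in> moebius_maps" using f k comp_mem_moebius inv_mem_moebius by (simp add: g_def)
  obtain a b where ab: "a \<noteq> 0" "\<And>z. g (Some z) = Some (a * z + b)"
    using affine_form[OF gM gN] by blast
  have fixed: "f w = w \<longleftrightarrow> g (k w) = k w" for w using k_eq[of "f w" w] by (simp add: kf)
  have surj: "\<exists>v. k v = w" for w using bij_moebius[OF k(1)] by (metis bij_pointE)
  show ?thesis
  proof (cases "a = 1")
    case True
    have "b \<noteq> 0"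
    proof
      assume "b = 0"
      then have "g w = w" for w using gN ab True by (cases w) auto
      then have "f = id" using fixed by auto
      then show False using f by simp
    qed
    have "g w = w \<longleftrightarrow> w = None" for w using gN ab True \<open>b \<noteq> 0\<close> by (cases w) auto
    then have "f w = w \<longleftrightarrow> w = x" for w using fixed k_eq[of w x] k(2) by simp
    then have "{z. f z = z} = {x, x}" by auto
    moreover have "inj (\<lambda>n::nat. f ^^ n)"
    proof (rule injI)
      fix m n :: nat assume eq: "f ^^ m = f ^^ n"
      have pow: "k ((f ^^ n) w) = (g ^^ n) (k w)" for n w
        by (induction n) (simp_all add: kf)
      have trans: "(g ^^ n) (Some 0) = Some (of_nat n * b)" for n
        using ab True by (induction n) (simp_all add: algebra_simps)
      obtain v where v: "k v = Some 0" using surj by blast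
      have "Some (of_nat m * b) = Some (of_nat n * b)"
        using pow[of m v] pow[of n v] unfolding eq v trans by auto
      then show "m = n" using \<open>b \<noteq> 0\<close> by simp
    qed
    ultimately show ?thesis using that by blast
  next
    case False
    have g_fixed: "g w = w \<longleftrightarrow> w = None \<or> w = Some (b / (1 - a))" for w
      using gN ab False by (cases w) (auto simp: field_simps)
    obtain y where y: "k y = Some (b / (1 - a))" using surj by blast
    have "f w = w \<longleftrightarrow> w = x \<or> w = y" for w
      using fixed g_fixed[of "k w"] k_eq[of w x] k_eq[of w y] k(2) y by simp
    then have "{z. f z = z} = {x, y}" by auto
    moreover have "x \<noteq> y" using k(2) y by auto
    ultimately show ?thesis using that by blast
  qed
qed

lemma moebius_eq_on_three:
  assumes "f \<in> moebius_maps" "g \<in> moebius_maps" "card A \<ge> 3" "\<And>x. x \<in> A \<Longrightarrow> f x = g x"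
  shows "f = g"
proof (rule ccontr)
  assume ne: "f \<noteq> g"
  have "inv' g \<circ> f \<noteq> id"
  proof
    assume "inv' g \<circ> f = id"
    then have "inv' g (f w) = w" for w by (metis comp_apply id_apply)
    then have "f w = g w" for w using inv_moebius_apply(2)[OF assms(2)] by metis
    then show False using ne by blast
  qed
  moreover have "inv' g \<circ> f \<in> moebius_maps" using assms comp_mem_moebius inv_mem_moebius by blast
  ultimately obtain x y where xy: "{z. (inv' g \<circ> f) z = z} = {x, y}" by (metis moebius_fixed_points)
  have "A \<subseteq> {x, y}" using assms by (auto simp flip: xy)
  then have "card A \<le> card {x, y}" by (intro card_mono) auto
  also have "\<dots> \<le> 2" by (simp add: card_insert_if)
  finally show False using assms(3) by simp
qed

lemma moebius_stabilizer_iff: "f \<in> moebius_stabilizer \<alpha> \<longleftrightarrow> f \<in> moebius_maps \<and> f ` \<alpha> = \<alpha>"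
  by (simp add: moebius_stabilizer_def stabilizer_def)

lemma finite_moebius_stabilizer:
  assumes "finite \<alpha>" "card \<alpha> \<ge> 3"
  shows "finite (moebius_stabilizer \<alpha>)"
proof (rule finite_imageD)
  show "inj_on (\<lambda>f. restrict f \<alpha>) (moebius_stabilizer \<alpha>)"
  proof (rule inj_onI)
    fix f g assume fg: "f \<in> moebius_stabilizer \<alpha>" "g \<in> moebius_stabilizer \<alpha>" "restrict f \<alpha> = restrict g \<alpha>"
    then have "f x = g x" if "x \<in> \<alpha>" for x using that by (metis restrict_apply')
    then show "f = g" using moebius_eq_on_three assms(2) fg by (simp add: moebius_stabilizer_iff)
  qed
  have "f x \<in> \<alpha>" if "f \<in> moebius_stabilizer \<alpha>" "x \<in> \<alpha>" for f x
    using that imageI[of x \<alpha> f] by (simp add: moebius_stabilizer_iff)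
  then have "(\<lambda>f. restrict f \<alpha>) ` moebius_stabilizer \<alpha> \<subseteq> \<alpha> \<rightarrow>\<^sub>E \<alpha>" by auto
  then show "finite ((\<lambda>f. restrict f \<alpha>) ` moebius_stabilizer \<alpha>)"
    using finite_PiE[OF assms(1), of "\<lambda>_. \<alpha>"] assms(1) finite_subset by blast
qed

lemma moebius_stabilizer_subset: "moebius_stabilizer \<alpha> \<subseteq> moebius_maps"
  by (auto simp: moebius_stabilizer_iff)

lemma moebius_image_eq_iff: "g \<in> moebius_maps \<Longrightarrow> g ` A = g ` B \<longleftrightarrow> A = B"
  using bij_moebius bij_is_inj inj_image_eq_iff by metis

lemma two_point_group_moebius:
  assumes "finite_perm_group H" "H \<subseteq> moebius_maps"
  shows "two_point_group H"
proof -
  interpret finite_perm_group H by fact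
  show ?thesis
  proof
    fix h assume h: "h \<in> H" "h \<noteq> id"
    obtain x y where xy: "{z. h z = z} = {x, y}" "x = y \<Longrightarrow> inj (\<lambda>n::nat. h ^^ n)"
      using moebius_fixed_points[of h] h assms(2) by blast
    have "h ^^ n \<in> H" for n
      by (induction n) (simp_all only: funpow.simps id_mem comp_mem h)
    then have "finite (range (\<lambda>n::nat. h ^^ n))"
      by (intro finite_subset[OF _ finite_H] image_subsetI)
    then have "\<not> inj (\<lambda>n::nat. h ^^ n)" using finite_imageD infinite_UNIV_nat by blast
    then have "x \<noteq> y" using xy(2) by blast
    then show "card {z. h z = z} = 2" unfolding xy(1) by simp
  qed
qed

lemma finite_perm_group_stabilizer:
  assumes "finite \<alpha>" "card \<alpha> \<ge> 3"
  shows "finite_perm_group (moebius_stabilizer \<alpha>)"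
proof
  show "finite (moebius_stabilizer \<alpha>)" by (rule finite_moebius_stabilizer[OF assms])
  show "id \<in> moebius_stabilizer \<alpha>" using id_mem_moebius by (simp add: moebius_stabilizer_iff)
  show "f \<circ> g \<in> moebius_stabilizer \<alpha>" if "f \<in> moebius_stabilizer \<alpha>" "g \<in> moebius_stabilizer \<alpha>" for f g
  proof -
    have "(f \<circ> g) ` \<alpha> = f ` g ` \<alpha>" by (simp add: image_comp)
    then show ?thesis using that comp_mem_moebius by (simp add: moebius_stabilizer_iff)
  qed
  fix f assume f: "f \<in> moebius_stabilizer \<alpha>"
  then obtain g where g: "g \<in> moebius_maps" "g \<circ> f = id" "f \<circ> g = id"
    using inverse_moebius by (metis moebius_stabilizer_iff)
  have "g ` \<alpha> = g ` f ` \<alpha>" using f by (simp add: moebius_stabilizer_iff)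
  also have "\<dots> = \<alpha>" using g(2) by (simp add: image_comp)
  finally show "\<exists>g\<in>moebius_stabilizer \<alpha>. g \<circ> f = id \<and> f \<circ> g = id"
    using g by (auto simp: moebius_stabilizer_iff)
qed

section \<open>The standard dihedral groups\<close>

definition rot :: "complex \<Rightarrow> sphere \<Rightarrow> sphere" where
  "rot c = moebius c 0 0 1"

definition inversion :: "complex \<Rightarrow> sphere \<Rightarrow> sphere" where
  "inversion c = moebius 0 c 1 0"

text \<open>The explicit list of the elements of \<open>standard_dihedral m\<close>, see \<open>standard_dihedral_eq\<close> below.\<close>

definition dihedral_maps :: "nat \<Rightarrow> (sphere \<Rightarrow> sphere) set" where
  "dihedral_maps m = {f. \<exists>c. c ^ m = 1 \<and> (f = rot c \<or> f = inversion c)}"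

lemma rot_apply [simp]: "rot c None = None" "rot c (Some z) = Some (c * z)"
  by (simp_all add: rot_def moebius_None moebius_Some)

lemma inversion_apply [simp]: "inversion c None = Some 0" "inversion c (Some z) = (if z = 0 then None else Some (c / z))"
  by (simp_all add: inversion_def moebius_None moebius_Some)

lemma rot_1: "rot 1 = id"
  by (rule sphere_fun_eqI) simp_all

lemma rot_rot: "rot c \<circ> rot d = rot (c * d)"
  by (rule sphere_fun_eqI) simp_all

lemma rot_inversion: "rot c \<circ> inversion d = inversion (c * d)"
  by (rule sphere_fun_eqI) simp_all

lemma inversion_rot: "d \<noteq> 0 \<Longrightarrow> inversion c \<circ> rot d = inversion (c / d)"
  by (rule sphere_fun_eqI) (simp_all add: field_simps)

lemma inversion_inversion: "c \<noteq> 0 \<Longrightarrow> d \<noteq> 0 \<Longrightarrow> inversion c \<circ> inversion d = rot (c / d)"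
  by (rule sphere_fun_eqI) (simp_all add: field_simps)

lemma rot_inject: "rot c = rot d \<longleftrightarrow> c = d"
proof
  assume "rot c = rot d"
  then have "rot c (Some 1) = rot d (Some 1)" by simp
  then show "c = d" by simp
qed simp

lemma inversion_inject: "inversion c = inversion d \<longleftrightarrow> c = d"
proof
  assume "inversion c = inversion d"
  then have "inversion c (Some 1) = inversion d (Some 1)" by simp
  then show "c = d" by simp
qed simp

lemma rot_ne_inversion: "rot c \<noteq> inversion d"
  by (metis option.distinct(1) inversion_apply(1) rot_apply(1))

lemma rot_mem: "c \<noteq> 0 \<Longrightarrow> rot c \<in> moebius_maps"
  and inversion_mem: "c \<noteq> 0 \<Longrightarrow> inversion c \<in> moebius_maps"
  by (auto simp: rot_def inversion_def intro!: moebius_mem)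

lemma root_of_unity_nonzero: "m > 0 \<Longrightarrow> (c::complex) ^ m = 1 \<Longrightarrow> c \<noteq> 0"
  by (auto simp: power_0_left)

lemma dihedral_mapsI: "c ^ m = 1 \<Longrightarrow> rot c \<in> dihedral_maps m" "c ^ m = 1 \<Longrightarrow> inversion c \<in> dihedral_maps m"
  by (auto simp: dihedral_maps_def)

lemma rot_mem_dihedral_iff: "rot c \<in> dihedral_maps m \<longleftrightarrow> c ^ m = 1"
  by (auto simp: dihedral_maps_def rot_inject rot_ne_inversion)

lemma dihedral_maps_subset: "m > 0 \<Longrightarrow> dihedral_maps m \<subseteq> moebius_maps"
  using rot_mem inversion_mem root_of_unity_nonzero by (auto simp: dihedral_maps_def)

lemma dihedral_maps_comp:
  assumes m: "m > 0" and "f \<in> dihedral_maps m" "g \<in> dihedral_maps m"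
  shows "f \<circ> g \<in> dihedral_maps m"
proof -
  obtain c d where cd: "c ^ m = 1" "f = rot c \<or> f = inversion c" "d ^ m = 1" "g = rot d \<or> g = inversion d"
    using assms by (auto simp: dihedral_maps_def)
  have "(c * d) ^ m = 1" "(c / d) ^ m = 1" using cd by (simp_all add: power_mult_distrib power_divide)
  moreover have "c \<noteq> 0" "d \<noteq> 0" using cd root_of_unity_nonzero[OF m] by blast+
  ultimately show ?thesis using cd
    by (auto simp: rot_rot rot_inversion inversion_rot inversion_inversion intro: dihedral_mapsI)
qed

lemma dihedral_maps_inverse:
  assumes m: "m > 0" and "f \<in> dihedral_maps m"
  obtains g where "g \<in> dihedral_maps m" "g \<circ> f = id" "f \<circ> g = id"
proof -
  obtain c where c: "c ^ m = 1" "f = rot c \<or> f = inversion c"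
    using assms by (auto simp: dihedral_maps_def)
  have c0: "c \<noteq> 0" using c root_of_unity_nonzero[OF m] by blast
  have "inverse c ^ m = 1" using c by (simp add: power_inverse)
  from c(2) show ?thesis
  proof
    assume "f = rot c"
    then show ?thesis
      using that[of "rot (inverse c)"] \<open>inverse c ^ m = 1\<close> c0 by (simp add: rot_rot rot_1 dihedral_mapsI)
  next
    assume "f = inversion c"
    then show ?thesis using that[of "inversion c"] c c0 by (simp add: inversion_inversion rot_1 dihedral_mapsI)
  qed
qed

lemma subgroup_dihedral_maps: "m > 0 \<Longrightarrow> subgroup (dihedral_maps m) moebius_group"
proof (rule group.subgroupI[OF group_moebius])
  assume m: "m > 0"
  show "dihedral_maps m \<subseteq> moebius_maps" by (rule dihedral_maps_subset[OF m])
  show "dihedral_maps m \<noteq> {}" using dihedral_mapsI(1)[of 1 m] by auto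
  fix f assume f: "f \<in> dihedral_maps m"
  obtain g where g: "g \<in> dihedral_maps m" "g \<circ> f = id" using dihedral_maps_inverse[OF m f] by blast
  then have "inv\<^bsub>moebius_group\<^esub> f = g"
    using f dihedral_maps_subset[OF m] by (intro group.inv_equality[OF group_moebius]) auto
  then show "inv\<^bsub>moebius_group\<^esub> f \<in> dihedral_maps m" using g by simp
next
  fix f g assume "m > 0" "f \<in> dihedral_maps m" "g \<in> dihedral_maps m"
  then show "f \<otimes>\<^bsub>moebius_group\<^esub> g \<in> dihedral_maps m" using dihedral_maps_comp by simp
qed

definition unit_root :: "nat \<Rightarrow> int \<Rightarrow> complex" where
  "unit_root m j = exp (of_int j / of_nat m * (2 * of_real pi * \<i>))"

lemma exp_int_two_pi: "exp (of_int j * (2 * of_real pi * \<i>)) = (1::complex)"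
  by (simp add: exp_eq_polar complex_eq_iff mult_ac) (metis Ints_of_int cos_int_2pin sin_int_2pin mult.commute mult.assoc)

lemma unit_root_add: "unit_root m (i + j) = unit_root m i * unit_root m j"
  by (simp add: unit_root_def add_divide_distrib ring_distribs exp_add)

lemma unit_root_nonzero: "unit_root m j \<noteq> 0"
  by (simp add: unit_root_def)

lemma unit_root_diff: "unit_root m (i - j) = unit_root m i / unit_root m j"
  using unit_root_add[of m "i - j" j] unit_root_nonzero[of m j] by (simp add: field_simps)

lemma unit_root_power: "unit_root m j ^ k = exp (of_nat k * (of_int j / of_nat m * (2 * of_real pi * \<i>)))"
  by (simp only: unit_root_def exp_of_nat_mult)

lemma unit_root_power_self: "m > 0 \<Longrightarrow> unit_root m j ^ m = 1"
  unfolding unit_root_power using exp_int_two_pi[of j] by simp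

lemma unit_root_of_nat: "unit_root m (int k) = unit_root m 1 ^ k"
  by (simp add: unit_root_power) (simp add: unit_root_def)

lemma roots_of_unity: "m > 0 \<Longrightarrow> c ^ m = 1 \<longleftrightarrow> (\<exists>j. c = unit_root m j)"
proof
  assume m: "m > 0" and "c ^ m = 1"
  then obtain k where "c = cis (2 * pi * real k / real m)"
    using bij_betw_roots_unity[OF m] by (force simp: bij_betw_def)
  then have "c = unit_root m (int k)" by (simp add: unit_root_def cis_conv_exp mult_ac)
  then show "\<exists>j. c = unit_root m j" ..
qed (auto simp: unit_root_power_self)

lemma unit_root_mod:
  assumes m: "m > 0"
  shows "unit_root m (j mod int m) = unit_root m j"
proof -
  have "unit_root m j = unit_root m (int m * (j div int m) + j mod int m)" by simp
  also have "\<dots> = unit_root m (int m * (j div int m)) * unit_root m (j mod int m)"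
    by (rule unit_root_add)
  also have "unit_root m (int m * (j div int m)) = 1"
    unfolding unit_root_def using exp_int_two_pi[of "j div int m"] m by simp
  finally show ?thesis by simp
qed

text \<open>The integer exponents match the first component of \<open>dihedral_group\<close>. Injectivity comes for free
  since there are exactly \<open>m\<close> roots of unity.\<close>

lemma bij_unit_root:
  assumes m: "m > 0"
  shows "bij_betw (unit_root m) {0..<int m} {c. c ^ m = 1}"
proof -
  have img: "unit_root m ` {0..<int m} = {c. c ^ m = 1}"
  proof (intro equalityI subsetI)
    fix c :: complex assume "c \<in> {c. c ^ m = 1}"
    then obtain j where "c = unit_root m (j mod int m)" using roots_of_unity[OF m] unit_root_mod[OF m] by auto
    then show "c \<in> unit_root m ` {0..<int m}" using m by (intro image_eqI[of _ _ "j mod int m"]) auto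
  qed (use unit_root_power_self[OF m] in auto)
  then have "inj_on (unit_root m) {0..<int m}"
    using card_roots_unity_eq[OF m] by (intro eq_card_imp_inj_on) simp_all
  then show ?thesis using img by (simp add: bij_betw_def)
qed

lemma standard_dihedral_eq:
  assumes m: "m > 0"
  shows "standard_dihedral m = dihedral_maps m"
proof
  interpret G: group moebius_group by (rule group_moebius)
  have gen: "standard_dihedral m = generate moebius_group {rot (unit_root m 1), inversion 1}"
    by (simp add: standard_dihedral_def rot_def inversion_def unit_root_def)
  show "standard_dihedral m \<subseteq> dihedral_maps m"
    unfolding gen
    by (rule G.generate_subgroup_incl[OF _ subgroup_dihedral_maps[OF m]])
       (simp add: dihedral_mapsI unit_root_power_self[OF m])
  have comp: "f \<circ> g \<in> standard_dihedral m" if "f \<in> standard_dihedral m" "g \<in> standard_dihedral m" for f g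
    using that generate.eng[of _ moebius_group] unfolding gen by fastforce
  have rot_pow: "rot (unit_root m 1 ^ k) \<in> standard_dihedral m" for k
  proof (induction k)
    case 0
    have "id \<in> standard_dihedral m"
      unfolding gen using generate.one[of moebius_group] by (metis one_moebius_group)
    then show ?case by (simp only: power_0 rot_1)
  next
    case (Suc k)
    have "rot (unit_root m 1) \<in> standard_dihedral m" unfolding gen by (rule generate.incl) simp
    from comp[OF this Suc] show ?case by (simp add: rot_rot)
  qed
  have inv1: "inversion 1 \<in> standard_dihedral m" unfolding gen by (rule generate.incl) simp
  show "dihedral_maps m \<subseteq> standard_dihedral m"
  proof
    fix f assume "f \<in> dihedral_maps m"
    then obtain c where c: "c ^ m = 1" "f = rot c \<or> f = inversion c" by (auto simp: dihedral_maps_def)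
    then obtain j where "c = unit_root m (j mod int m)" using roots_of_unity[OF m] unit_root_mod[OF m] by auto
    moreover have "j mod int m = int (nat (j mod int m))" using m by simp
    ultimately have "c = unit_root m 1 ^ nat (j mod int m)" by (metis unit_root_of_nat)
    then have r: "rot c \<in> standard_dihedral m" using rot_pow by simp
    then show "f \<in> standard_dihedral m" using c(2) comp[OF r inv1] by (auto simp: rot_inversion)
  qed
qed

text \<open>The pair \<open>(i, s)\<close> corresponds to \<open>z \<mapsto> \<omega>\<^sup>i z\<close> or \<open>z \<mapsto> \<omega>\<^sup>i / z\<close> with \<open>\<omega>\<close> the primitive
  root. This map respects products for all integers \<open>i\<close>, not only for reduced ones, which makes the
  reduction modulo \<open>n\<close> harmless. The isomorphism is its inverse.\<close>

lemma standard_dihedral_iso: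
  assumes n: "n > 0"
  shows "moebius_group\<lparr>carrier := standard_dihedral n\<rparr> \<cong> dihedral_group n"
proof -
  let ?D = "dihedral_group n" and ?G = "moebius_group\<lparr>carrier := standard_dihedral n\<rparr>"
  define F where "F = (\<lambda>(i, s). if s then inversion (unit_root n i) else rot (unit_root n i))"
  have bij: "bij_betw F (carrier ?D) (carrier ?G)"
    unfolding bij_betw_def
  proof
    have inj: "i = j" if "i \<in> {0..<int n}" "j \<in> {0..<int n}" "unit_root n i = unit_root n j" for i j
      using bij_unit_root[OF n] that by (metis bij_betw_imp_inj_on inj_onD)
    show "inj_on F (carrier ?D)"
      using inj by (auto simp: inj_on_def F_def dihedral_group_def rot_inject inversion_inject rot_ne_inversion
          rot_ne_inversion[symmetric] split: if_splits)
    have "F ` carrier ?D = rot ` unit_root n ` {0..<int n} \<union> inversion ` unit_root n ` {0..<int n}"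
      by (force simp: F_def dihedral_group_def)
    also have "unit_root n ` {0..<int n} = {c. c ^ n = 1}"
      using bij_unit_root[OF n] by (simp add: bij_betw_def)
    also have "rot ` {c. c ^ n = 1} \<union> inversion ` {c. c ^ n = 1} = carrier ?G"
      by (auto simp: standard_dihedral_eq[OF n] dihedral_maps_def)
    finally show "F ` carrier ?D = carrier ?G" .
  qed
  have closed: "x \<otimes>\<^bsub>?D\<^esub> y \<in> carrier ?D" for x y
    using n by (auto simp: dihedral_group_def split: prod.splits)
  have hom: "F (x \<otimes>\<^bsub>?D\<^esub> y) = F x \<circ> F y" for x y
    by (cases x; cases y)
       (auto simp: dihedral_group_def F_def unit_root_mod[OF n] unit_root_add unit_root_diff
          rot_rot rot_inversion inversion_rot inversion_inversion unit_root_nonzero)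
  define E where "E = inv_into (carrier ?D) F"
  have E: "bij_betw E (carrier ?G) (carrier ?D)" unfolding E_def by (rule bij_betw_inv_into[OF bij])
  have "E \<in> hom ?G ?D"
  proof (rule homI)
    fix f g assume fg: "f \<in> carrier ?G" "g \<in> carrier ?G"
    have "F (E f \<otimes>\<^bsub>?D\<^esub> E g) = f \<otimes>\<^bsub>?G\<^esub> g"
      using bij_betw_inv_into_right[OF bij] fg by (simp add: hom E_def)
    then show "E (f \<otimes>\<^bsub>?G\<^esub> g) = E f \<otimes>\<^bsub>?D\<^esub> E g"
      using bij_betw_inv_into_left[OF bij closed] unfolding E_def by metis
  qed (use E in \<open>auto dest: bij_betw_apply\<close>)
  then have "E \<in> iso ?G ?D" using E by (simp add: iso_def)
  then show ?thesis by (auto simp: is_iso_def)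
qed

lemma dihedral_maps_2: "dihedral_maps 2 = {rot 1, rot (-1), inversion 1, inversion (-1)}"
  by (auto simp: dihedral_maps_def power2_eq_1_iff)

lemma phi_mem: "phi \<in> moebius_maps"
  unfolding phi_def by (rule moebius_mem) simp

lemma psi_mem: "psi \<in> moebius_maps"
  unfolding psi_def by (rule moebius_mem) simp

text \<open>Conjugation by \<open>phi\<close> permutes the three involutions \<open>-z\<close>, \<open>1/z\<close>, \<open>-1/z\<close> of the Klein four-group: it
  exchanges the first two and fixes the third.\<close>

lemma phi_normalizes: "f \<in> dihedral_maps 2 \<Longrightarrow> \<exists>f'\<in>dihedral_maps 2. phi \<circ> f = f' \<circ> phi"
proof -
  have "phi \<circ> rot (-1) = inversion 1 \<circ> phi" "phi \<circ> inversion 1 = rot (-1) \<circ> phi"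
    "phi \<circ> inversion (-1) = inversion (-1) \<circ> phi"
    unfolding phi_def rot_def inversion_def
    using moebius_scale[of "-1" 1 1 1 "-1"] moebius_scale[of "-1" 1 "-1" "-1" "-1"]
      moebius_scale[of "-1" "-1" "-1" 1 "-1"]
    by (simp_all add: moebius_comp)
  then show "f \<in> dihedral_maps 2 \<Longrightarrow> \<exists>f'\<in>dihedral_maps 2. phi \<circ> f = f' \<circ> phi"
    unfolding dihedral_maps_2 by (auto simp: rot_1)
qed

text \<open>Conjugation by \<open>psi\<close> exchanges \<open>-z\<close> with \<open>-1/z\<close> and fixes \<open>1/z\<close>.\<close>

lemma psi_normalizes: "f \<in> dihedral_maps 2 \<Longrightarrow> \<exists>f'\<in>dihedral_maps 2. psi \<circ> f = f' \<circ> psi"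
proof -
  have "psi \<circ> rot (-1) = inversion (-1) \<circ> psi" "psi \<circ> inversion 1 = inversion 1 \<circ> psi"
    "psi \<circ> inversion (-1) = rot (-1) \<circ> psi"
    unfolding psi_def rot_def inversion_def
    using moebius_scale[of "- \<i>" "- \<i>" "-1" 1 \<i>] moebius_scale[of \<i> 1 "- \<i>" "- \<i>" "1"]
      moebius_scale[of \<i> \<i> "-1" 1 "- \<i>"]
    by (simp_all add: moebius_comp)
  then show "f \<in> dihedral_maps 2 \<Longrightarrow> \<exists>f'\<in>dihedral_maps 2. psi \<circ> f = f' \<circ> psi"
    unfolding dihedral_maps_2 by (auto simp: rot_1)
qed

text \<open>The 3-cycles \<open>(1 2 3)\<close> and \<open>(1 2 4)\<close> have squares that do not commute.\<close>

lemma squares_commute_imp_no_three_cycles: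
  assumes iso: "G \<cong> L" and G: "group G"
    and squares: "\<And>x y. x \<in> carrier G \<Longrightarrow> y \<in> carrier G \<Longrightarrow>
      (x \<otimes>\<^bsub>G\<^esub> x) \<otimes>\<^bsub>G\<^esub> (y \<otimes>\<^bsub>G\<^esub> y) = (y \<otimes>\<^bsub>G\<^esub> y) \<otimes>\<^bsub>G\<^esub> (x \<otimes>\<^bsub>G\<^esub> x)"
    and L: "monoid.mult L = (\<circ>)" "three_cycles 4 \<subseteq> carrier L"
  shows False
proof -
  interpret group G by fact
  obtain h where h: "h \<in> hom G L" "bij_betw h (carrier G) (carrier L)"
    using iso by (auto simp: is_iso_def iso_def)
  define p q where "p = cycle_of_list [1, 2, 3::nat]" and "q = cycle_of_list [1, 2, 4::nat]"
  have "p \<in> three_cycles 4" unfolding p_def by (rule CollectI, rule exI[of _ "[1, 2, 3]"]) simp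
  moreover have "q \<in> three_cycles 4" unfolding q_def by (rule CollectI, rule exI[of _ "[1, 2, 4]"]) simp
  ultimately have pL: "p \<in> carrier L" "q \<in> carrier L" using L(2) by blast+
  obtain x y where xy: "x \<in> carrier G" "y \<in> carrier G" "h x = p" "h y = q"
    using h(2) pL by (metis bij_betw_imp_surj_on imageE)
  have sq: "h ((x \<otimes>\<^bsub>G\<^esub> x) \<otimes>\<^bsub>G\<^esub> (y \<otimes>\<^bsub>G\<^esub> y)) = (h x \<circ> h x) \<circ> (h y \<circ> h y)"
    if "x \<in> carrier G" "y \<in> carrier G" for x y
    using h(1) that by (simp add: hom_mult L(1))
  have "(p \<circ> p) \<circ> (q \<circ> q) = (q \<circ> q) \<circ> (p \<circ> p)"
    using sq[OF xy(1,2)] sq[OF xy(2,1)] squares[OF xy(1,2)] xy by metis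
  then have "((p \<circ> p) \<circ> (q \<circ> q)) 1 = ((q \<circ> q) \<circ> (p \<circ> p)) 1" by simp
  then show False by (simp add: p_def q_def transpose_def)
qed

lemma dihedral_not_polyhedral:
  assumes n: "n > 0"
  shows "\<not> moebius_group\<lparr>carrier := dihedral_maps n\<rparr> \<cong> alt_group 5"
    and "\<not> moebius_group\<lparr>carrier := dihedral_maps n\<rparr> \<cong> sym_group 4"
    and "\<not> moebius_group\<lparr>carrier := dihedral_maps n\<rparr> \<cong> alt_group 4"
proof -
  let ?G = "moebius_group\<lparr>carrier := dihedral_maps n\<rparr>"
  have G: "group ?G"
    using subgroup.subgroup_is_group[OF subgroup_dihedral_maps[OF n] group_moebius] .
  have square: "\<exists>c. f \<circ> f = rot c" if f: "f \<in> dihedral_maps n" for f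
  proof -
    obtain c where "c ^ n = 1" "f = rot c \<or> f = inversion c" using f by (auto simp: dihedral_maps_def)
    then show ?thesis using root_of_unity_nonzero[OF n] by (auto simp: rot_rot inversion_inversion)
  qed
  have squares: "(f \<otimes>\<^bsub>?G\<^esub> f) \<otimes>\<^bsub>?G\<^esub> (g \<otimes>\<^bsub>?G\<^esub> g) = (g \<otimes>\<^bsub>?G\<^esub> g) \<otimes>\<^bsub>?G\<^esub> (f \<otimes>\<^bsub>?G\<^esub> f)"
    if "f \<in> carrier ?G" "g \<in> carrier ?G" for f g
  proof -
    have "f \<in> dihedral_maps n" "g \<in> dihedral_maps n" using that by simp_all
    then obtain c d where "f \<circ> f = rot c" "g \<circ> g = rot d"
      using square by blast
    then show ?thesis by (simp add: rot_rot mult.commute)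
  qed
  have mono: "three_cycles 4 \<subseteq> three_cycles 5"
  proof
    fix p :: "nat \<Rightarrow> nat" assume "p \<in> three_cycles 4"
    then obtain cs where "p = cycle_of_list cs" "cycle cs" "length cs = 3" "set cs \<subseteq> {1..4}" by auto
    moreover have "{1..4} \<subseteq> {1..5::nat}" by auto
    ultimately show "p \<in> three_cycles 5" by blast
  qed
  have sub: "three_cycles 4 \<subseteq> carrier (alt_group 5)" using mono three_cycles_incl[of 5] by (rule order_trans)
  have "carrier (alt_group 4) \<subseteq> carrier (sym_group 4)" by (auto simp: alt_group_carrier sym_group_carrier)
  then have sym: "three_cycles 4 \<subseteq> carrier (sym_group 4)" using three_cycles_incl[of 4] by (rule order_trans[rotated])
  note no_iso = squares_commute_imp_no_three_cycles[OF _ G squares]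
  show "\<not> ?G \<cong> alt_group 5" by (rule notI) (rule no_iso[OF _ _ _ alt_group_mult sub])
  show "\<not> ?G \<cong> sym_group 4" by (rule notI) (rule no_iso[OF _ _ _ sym_group_mult sym])
  show "\<not> ?G \<cong> alt_group 4"
    by (rule notI) (rule no_iso[OF _ _ _ alt_group_mult three_cycles_incl])
qed

section \<open>Unions of dihedral orbits\<close>

lemma set_A_roots: "m > 0 \<Longrightarrow> set_A m = Some ` {c. c ^ m = 1}"
  using roots_of_unity[of m] by (auto simp: set_A_def unit_root_def)

lemma set_C_roots:
  assumes "m > 0"
  shows "set_C m z = Some ` {z * c |c. c ^ m = 1} \<union> Some ` {inverse z * c |c. c ^ m = 1}"
  using roots_of_unity[OF assms] by (fastforce simp: set_C_def unit_root_def)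

text \<open>Multiplication by one \<open>m\<close>-th root of \<open>-1\<close> carries the roots of \<open>1\<close> to the roots of \<open>-1\<close>.\<close>

lemma set_B_roots:
  assumes m: "m > 0"
  shows "set_B m = Some ` {c. c ^ m = -1}"
proof -
  \<comment> \<open>an \<open>m\<close>-th root of \<open>-1\<close>\<close>
  define \<zeta> :: complex where "\<zeta> = exp (1 / of_nat (2 * m) * (2 * of_real pi * \<i>))"
  have "\<zeta> ^ m = exp (of_nat m * (1 / of_nat (2 * m) * (2 * of_real pi * \<i>)))"
    by (simp only: \<zeta>_def exp_of_nat_mult)
  also have "of_nat m * (1 / of_nat (2 * m) * (2 * of_real pi * \<i>)) = of_real pi * \<i>"
    using m by simp
  finally have \<zeta>: "\<zeta> ^ m = -1" by simp
  have "exp (of_int (2 * j + 1) / of_nat (2 * m) * (2 * of_real pi * \<i>)) = \<zeta> * unit_root m j" for j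
  proof -
    have "of_int (2 * j + 1) / of_nat (2 * m) = (1 / of_nat (2 * m) + of_int j / of_nat m :: complex)"
      using m by (simp add: field_simps)
    then show ?thesis by (simp only: \<zeta>_def unit_root_def ring_distribs(2) exp_add)
  qed
  then have B: "set_B m = {Some (\<zeta> * unit_root m j) |j. True}" by (simp add: set_B_def)
  have "c ^ m = -1 \<longleftrightarrow> (\<exists>j. c = \<zeta> * unit_root m j)" for c
  proof -
    have z0: "\<zeta> \<noteq> 0" by (simp add: \<zeta>_def)
    have "c ^ m = -1 \<longleftrightarrow> (c / \<zeta>) ^ m = 1" by (simp add: power_divide \<zeta>) (metis minus_minus)
    also have "\<dots> \<longleftrightarrow> (\<exists>j. c = \<zeta> * unit_root m j)"
      using roots_of_unity[OF m, of "c / \<zeta>"] z0 by (simp add: field_simps)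
    finally show ?thesis .
  qed
  then show ?thesis unfolding B by auto
qed

lemma excluded_parameters: "m > 0 \<Longrightarrow>
  {exp (of_int l / of_nat (2 * m) * (2 * of_real pi * \<i>)) |l :: int. True} = {c. c ^ (2 * m) = 1}"
  using roots_of_unity[of "2 * m"] by (auto simp: unit_root_def)

text \<open>The members of the family in terms of roots of unity: each is an orbit of \<open>dihedral_maps m\<close>.
  The excluded parameters \<open>z\<close> are those with \<open>z\<^sup>m = 1\<close> or \<open>z\<^sup>m = -1\<close>, whose orbits are the two sets
  before.\<close>

lemma orbit_family_cases:
  assumes m: "m > 0"
  shows "S \<in> orbit_family m \<longleftrightarrow> S = {Some 0, None} \<or> S = Some ` {c. c ^ m = 1} \<or> S = Some ` {c. c ^ m = -1}
    \<or> (\<exists>z. z \<noteq> 0 \<and> z ^ (2 * m) \<noteq> 1 \<and>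
          S = Some ` {z * c |c. c ^ m = 1} \<union> Some ` {inverse z * c |c. c ^ m = 1})"
  unfolding orbit_family_def excluded_parameters[OF m] set_V_def set_A_roots[OF m] set_B_roots[OF m]
    set_C_roots[OF m] by auto

lemma orbit_family_invariant:
  assumes m: "m > 0" and S: "S \<in> orbit_family m" and f: "f \<in> dihedral_maps m"
  shows "f ` S \<subseteq> S"
proof -
  obtain c where c: "c ^ m = 1" "f = rot c \<or> f = inversion c" using f by (auto simp: dihedral_maps_def)
  have c0: "c \<noteq> 0" using c root_of_unity_nonzero[OF m] by blast
  consider "S = {Some 0, None}" | "S = Some ` {c. c ^ m = 1}" | "S = Some ` {c. c ^ m = -1}"
    | z where "z \<noteq> 0" "S = Some ` {z * c |c. c ^ m = 1} \<union> Some ` {inverse z * c |c. c ^ m = 1}"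
    using S unfolding orbit_family_cases[OF m] by blast
  then show ?thesis
  proof cases
    case 1
    then show ?thesis using c(2) by auto
  next
    case 2
    then show ?thesis using c m by (auto simp: power_mult_distrib power_divide power_0_left)
  next
    case 3
    then show ?thesis using c m by (auto simp: power_mult_distrib power_divide power_0_left)
  next
    case (4 z)
    have mult: "(c * d) ^ m = 1" "(c / d) ^ m = 1" "d \<noteq> 0" if "d ^ m = 1" for d
      using that c root_of_unity_nonzero[OF m] by (auto simp: power_mult_distrib power_divide)
    show ?thesis
    proof
      fix w assume "w \<in> f ` S"
      then obtain d where d: "d ^ m = 1" "w = f (Some (z * d)) \<or> w = f (Some (inverse z * d))"
        unfolding 4(2) by auto
      then have "w = Some (z * (c * d)) \<or> w = Some (inverse z * (c * d))
          \<or> w = Some (inverse z * (c / d)) \<or> w = Some (z * (c / d))"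
        using c(2) 4(1) mult(3) by (auto simp: field_simps)
      then show "w \<in> S" unfolding 4(2) using mult[OF d(1)] by blast
    qed
  qed
qed

text \<open>The members cover the sphere, and the group acts transitively on each of them. So a member that
  meets an invariant set is contained in it.\<close>

lemma union_of_orbits_iff:
  assumes m: "m > 0"
  shows "union_of_some (orbit_family m) \<alpha> \<longleftrightarrow> dihedral_maps m \<subseteq> moebius_stabilizer \<alpha>"
proof
  assume "union_of_some (orbit_family m) \<alpha>"
  then obtain \<S> where \<S>: "\<S> \<subseteq> orbit_family m" "\<alpha> = \<Union>\<S>" by (auto simp: union_of_some_def)
  have sub: "f ` \<alpha> \<subseteq> \<alpha>" if f: "f \<in> dihedral_maps m" for f
    using orbit_family_invariant[OF m _ f] \<S> by blast
  show "dihedral_maps m \<subseteq> moebius_stabilizer \<alpha>"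
  proof
    fix f assume f: "f \<in> dihedral_maps m"
    obtain g where g: "g \<in> dihedral_maps m" "f \<circ> g = id" using dihedral_maps_inverse[OF m f] by blast
    have "\<alpha> = f ` g ` \<alpha>" using g(2) by (simp add: image_comp)
    then have "\<alpha> \<subseteq> f ` \<alpha>" using image_mono[OF sub[OF g(1)], of f] by simp
    then show "f \<in> moebius_stabilizer \<alpha>"
      using sub[OF f] f dihedral_maps_subset[OF m] by (auto simp: moebius_stabilizer_iff)
  qed
next
  assume D: "dihedral_maps m \<subseteq> moebius_stabilizer \<alpha>"
  have inv: "f x \<in> \<alpha>" if "f \<in> dihedral_maps m" "x \<in> \<alpha>" for f x
  proof -
    have "f \<in> moebius_stabilizer \<alpha>" using that(1) D by blast
    then have "f ` \<alpha> = \<alpha>" by (simp add: moebius_stabilizer_iff)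
    then show ?thesis using imageI[OF that(2), of f] by simp
  qed
  have rot: "Some (c * z) \<in> \<alpha>" if "c ^ m = 1" "Some z \<in> \<alpha>" for c z
    using inv[OF dihedral_mapsI(1)[OF that(1)] that(2)] by simp
  have cover: "\<exists>S\<in>orbit_family m. x \<in> S \<and> S \<subseteq> \<alpha>" if x: "x \<in> \<alpha>" for x
  proof (cases "x \<in> {Some 0, None}")
    case True
    have "inversion 1 x \<in> \<alpha>" using inv[OF dihedral_mapsI(2)[of 1] x] by simp
    then have "{Some 0, None} \<subseteq> \<alpha>" using True x by auto
    moreover have "{Some 0, None} \<in> orbit_family m" unfolding orbit_family_cases[OF m] by blast
    ultimately show ?thesis using True by (intro bexI[of _ "{Some 0, None}"] conjI)
  next
    case False
    then obtain z where z: "x = Some z" "z \<noteq> 0" by (cases x) auto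
    consider "z ^ m = 1" | "z ^ m = -1" | "z ^ (2 * m) \<noteq> 1"
      using power2_eq_1_iff[of "z ^ m"] by (auto simp: power_even_eq)
    then show ?thesis
    proof cases
      case 1
      have "Some d \<in> \<alpha>" if "d ^ m = 1" for d
        using rot[of "d / z" z] that 1 z x by (simp add: power_divide)
      then show ?thesis
        using 1 z orbit_family_cases[OF m] by (intro bexI[of _ "Some ` {c. c ^ m = 1}"]) auto
    next
      case 2
      have "Some d \<in> \<alpha>" if "d ^ m = -1" for d
        using rot[of "d / z" z] that 2 z x by (simp add: power_divide)
      then show ?thesis
        using 2 z orbit_family_cases[OF m] by (intro bexI[of _ "Some ` {c. c ^ m = -1}"]) auto
    next
      case 3
      let ?S = "Some ` {z * c |c. c ^ m = 1} \<union> Some ` {inverse z * c |c. c ^ m = 1}"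
      have "inversion 1 x \<in> \<alpha>" using inv[OF dihedral_mapsI(2)[of 1] x] by simp
      then have "Some (inverse z) \<in> \<alpha>" using z by (simp add: inverse_eq_divide)
      then have S1: "?S \<subseteq> \<alpha>" using rot[of _ z] rot[of _ "inverse z"] x z by (auto simp: mult.commute)
      have S2: "x \<in> ?S" unfolding z(1) by (intro UnI1 imageI) (auto intro: exI[of _ 1])
      have "?S \<in> orbit_family m" unfolding orbit_family_cases[OF m] using 3 z by blast
      then show ?thesis using S1 S2 by (intro bexI[of _ ?S] conjI)
    qed
  qed
  show "union_of_some (orbit_family m) \<alpha>"
    unfolding union_of_some_def
  proof (intro exI[of _ "{S \<in> orbit_family m. S \<subseteq> \<alpha>}"] conjI equalityI subsetI)
    fix x assume "x \<in> \<alpha>"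
    then show "x \<in> \<Union> {S \<in> orbit_family m. S \<subseteq> \<alpha>}" using cover[of x] by blast
  qed auto
qed

text \<open>Only the rotations matter: there are \<open>m\<close> of them in the smaller group and \<open>n\<close> in the larger.\<close>

lemma dihedral_maps_subset_imp_le:
  assumes m: "m > 0" and n: "n > 0" and sub: "dihedral_maps m \<subseteq> dihedral_maps n"
  shows "m \<le> n"
proof -
  have "{c::complex. c ^ m = 1} \<subseteq> {c. c ^ n = 1}"
    using sub rot_mem_dihedral_iff by blast
  then have "card {c::complex. c ^ m = 1} \<le> card {c::complex. c ^ n = 1}"
    using n by (intro card_mono finite_roots_unity) auto
  then show ?thesis using m n by (simp add: card_roots_unity_eq)
qed

text \<open>Reduces the families transported by \<open>phi\<close> and \<open>psi\<close> to the standard one, at the price of replacing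
  the set by its preimage.\<close>

lemma union_of_image_family:
  assumes g: "g \<in> moebius_maps"
  shows "union_of_some ((`) g ` F) \<alpha> \<longleftrightarrow> union_of_some F (inv' g ` \<alpha>)"
proof
  assume "union_of_some ((`) g ` F) \<alpha>"
  then obtain S where S: "S \<subseteq> F" "\<alpha> = \<Union> ((`) g ` S)"
    unfolding union_of_some_def by (auto simp: subset_image_iff)
  have "inv' g ` \<alpha> = \<Union> S" unfolding S(2) using g by (simp add: image_UN image_image)
  then show "union_of_some F (inv' g ` \<alpha>)" using S by (auto simp: union_of_some_def)
next
  assume "union_of_some F (inv' g ` \<alpha>)"
  then obtain S where S: "S \<subseteq> F" "inv' g ` \<alpha> = \<Union> S" by (auto simp: union_of_some_def)
  have "\<alpha> = g ` inv' g ` \<alpha>" using g by (simp add: image_image)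
  also have "\<dots> = \<Union> ((`) g ` S)" unfolding S(2) by blast
  finally show "union_of_some ((`) g ` F) \<alpha>" using S(1) by (auto simp: union_of_some_def)
qed

section \<open>The invariant axis\<close>

lemma dihedral_no_fixed_point:
  assumes n: "n \<ge> 2"
  shows "\<exists>f\<in>dihedral_maps n. f x \<noteq> x"
proof -
  have "card {c::complex. c ^ n = 1} = n" using n by (simp add: card_roots_unity_eq)
  then have "\<not> {c::complex. c ^ n = 1} \<subseteq> {1}"
    using card_mono[of "{1}" "{c::complex. c ^ n = 1}"] n by auto
  then obtain c :: complex where c: "c ^ n = 1" "c \<noteq> 1" by auto
  show ?thesis
  proof (cases "x \<in> {None, Some 0}")
    case True
    then show ?thesis using dihedral_mapsI(2)[of 1 n] by (intro bexI[of _ "inversion 1"]) auto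
  next
    case False
    then show ?thesis using dihedral_mapsI(1)[OF c(1)] c(2) by (intro bexI[of _ "rot c"]) (cases x, auto)
  qed
qed

text \<open>A pair that meets \<open>{0, \<infinity>}\<close> equals it by invariance under \<open>1/z\<close>. Otherwise a rotation is determined
  by the image of one point of the pair, so there are at most two rotations and \<open>n = 2\<close>. The pair is
  then \<open>{u, -u}\<close>, and \<open>1/u\<close> being \<open>u\<close> or \<open>-u\<close> leaves \<open>u\<^sup>2 = 1\<close> or \<open>u\<^sup>2 = -1\<close>.\<close>

lemma dihedral_invariant_pair:
  assumes n: "n \<ge> 2" and xy: "x \<noteq> y" and pair: "\<And>f. f \<in> dihedral_maps n \<Longrightarrow> f ` {x, y} = {x, y}"
  shows "{x, y} = {Some 0, None}
    \<or> n = 2 \<and> ({x, y} = phi ` {Some 0, None} \<or> {x, y} = psi ` {Some 0, None})"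
proof -
  have mem: "f w \<in> {x, y}" if "f \<in> dihedral_maps n" "w \<in> {x, y}" for f w
    using pair[OF that(1)] that(2) by blast
  have inv1: "inversion 1 \<in> dihedral_maps n" by (rule dihedral_mapsI) simp
  show ?thesis
  proof (cases "{x, y} \<inter> {Some 0, None} = {}")
    case False
    then have "{Some 0, None} \<subseteq> {x, y}" using mem[OF inv1, of "Some 0"] mem[OF inv1, of None] by auto
    then show ?thesis using xy by auto
  next
    case True
    then obtain u v where uv: "x = Some u" "y = Some v" "u \<noteq> 0" "v \<noteq> 0" "u \<noteq> v"
      using xy by (cases x; cases y) auto
    have roots: "{c. c ^ n = 1} \<subseteq> {1, v / u}"
    proof
      fix c :: complex assume "c \<in> {c. c ^ n = 1}"
      then have "Some (c * u) \<in> {Some u, Some v}"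
        using mem[OF dihedral_mapsI(1)[of c n], of "Some u"] uv by simp
      then show "c \<in> {1, v / u}" using uv by (auto simp: field_simps)
    qed
    have "n = card {c::complex. c ^ n = 1}" using n by (simp add: card_roots_unity_eq)
    also have "\<dots> \<le> card {1, v / u}" by (rule card_mono[OF _ roots]) simp
    also have "\<dots> \<le> 2" by (simp add: card_insert_if)
    finally have n2: "n = 2" using n by simp
    then have "-1 \<in> {c::complex. c ^ n = 1}" by simp
    then have "-1 \<in> {1, v / u}" using roots by blast
    then have v: "v = - u" using uv by (auto simp: field_simps)
    have "Some (1 / u) \<in> {Some u, Some v}" using mem[OF inv1, of "Some u"] uv by simp
    then have "u\<^sup>2 = 1 \<or> - (u\<^sup>2) = 1" using uv by (auto simp: v field_simps power2_eq_square)
    then have "u\<^sup>2 = 1 \<or> u\<^sup>2 = \<i>\<^sup>2" by (metis minus_minus power2_i)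
    then have "u = 1 \<or> u = -1 \<or> u = \<i> \<or> u = - \<i>"
      unfolding power2_eq_iff power2_eq_1_iff by blast
    moreover have "phi ` {Some 0, None} = {Some 1, Some (-1)}" "psi ` {Some 0, None} = {Some \<i>, Some (- \<i>)}"
      by (auto simp: phi_def psi_def moebius_None moebius_Some)
    moreover have "{x, y} = {Some u, Some (- u)}" using uv v by simp
    ultimately have "{x, y} = phi ` {Some 0, None} \<or> {x, y} = psi ` {Some 0, None}"
      by (elim disjE) (simp_all add: insert_commute)
    then show ?thesis using n2 by blast
  qed
qed

text \<open>Multiplication by an element \<open>c\<close> permutes \<open>R\<close>, so the product over \<open>R\<close> is unchanged when it is
  multiplied by \<open>c ^ card R\<close>. Hence \<open>R\<close> consists of \<open>card R\<close> many roots of unity of order dividing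
  \<open>card R\<close>, and there are no others.\<close>

lemma root_group_is_roots_of_unity:
  fixes R :: "complex set"
  assumes fin: "finite R" and zero: "0 \<notin> R" and one: "1 \<in> R"
    and mult: "\<And>c d. c \<in> R \<Longrightarrow> d \<in> R \<Longrightarrow> c * d \<in> R"
  shows "R = {c. c ^ card R = 1}"
proof (rule card_subset_eq)
  have pos: "card R > 0" using fin one by (auto simp: card_gt_0_iff)
  then show "finite {c::complex. c ^ card R = 1}" by (intro finite_roots_unity) simp
  show "card R = card {c::complex. c ^ card R = 1}" using pos by (simp add: card_roots_unity_eq)
  show "R \<subseteq> {c. c ^ card R = 1}"
  proof
    fix c assume c: "c \<in> R"
    then have c0: "c \<noteq> 0" using zero by blast
    have inj: "inj_on ((*) c) R" using c0 by (simp add: inj_on_def)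
    have "(*) c ` R = R" using mult[OF c] inj by (intro endo_inj_surj[OF fin]) auto
    then have "prod id R = prod id ((*) c ` R)" by simp
    also have "\<dots> = (\<Prod>d\<in>R. c * d)" by (simp add: prod.reindex[OF inj])
    also have "\<dots> = c ^ card R * prod id R" by (simp add: prod.distrib)
    finally have "prod id R = c ^ card R * prod id R" .
    moreover have "prod id R \<noteq> 0" using fin zero by (simp add: prod_zero_iff)
    ultimately show "c \<in> {c. c ^ card R = 1}" by simp
  qed
qed

text \<open>The maps in \<open>H\<close> that fix \<open>0\<close> and \<open>\<infinity>\<close> are the multiplications by a finite group of complex numbers,
  that is, by all \<open>m\<close>-th roots of unity for some \<open>m\<close>. The others differ from these by \<open>1/z\<close>, which lies
  in \<open>H\<close>. By Lagrange's theorem for the rotations, \<open>n\<close> divides \<open>m\<close>.\<close>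

lemma standard_axis:
  assumes H: "finite_perm_group H" "H \<subseteq> moebius_maps" and n: "n > 0" "dihedral_maps n \<subseteq> H"
    and axis: "\<And>h. h \<in> H \<Longrightarrow> h ` {Some 0, None} = {Some 0, None}"
  obtains p where "p > 0" "H = dihedral_maps (p * n)"
proof -
  interpret finite_perm_group H by fact
  define R where "R = {c. rot c \<in> H}"
  have inv1: "inversion 1 \<in> H" using n dihedral_mapsI(2)[of 1 n] by auto
  have "finite (rot ` R)" using finite_H by (rule finite_subset[rotated]) (auto simp: R_def)
  then have finR: "finite R" by (rule finite_imageD) (simp add: inj_on_def rot_inject)
  have zero: "0 \<notin> R"
  proof
    assume "0 \<in> R"
    then have "rot 0 \<in> H" by (simp add: R_def)
    moreover have "rot 0 (Some 0) = rot 0 (Some 1)" by simp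
    ultimately show False using apply_eq_iff by (metis option.inject zero_neq_one)
  qed
  define m where "m = card R"
  have R: "R = {c. c ^ m = 1}"
    unfolding m_def
  proof (rule root_group_is_roots_of_unity[OF finR zero])
    show "1 \<in> R" using id_mem by (simp add: R_def rot_1)
    show "c * d \<in> R" if "c \<in> R" "d \<in> R" for c d
      using that comp_mem[of "rot c" "rot d"] by (simp add: R_def rot_rot)
  qed
  have m: "m > 0" using finR id_mem by (auto simp: m_def card_gt_0_iff R_def rot_1[symmetric])
  have fix_case: "\<exists>c\<in>R. h = rot c" if h: "h \<in> H" "h None = None" for h
  proof -
    obtain a b where ab: "a \<noteq> 0" "\<And>z. h (Some z) = Some (a * z + b)"
      using affine_form[of h] h H(2) by blast
    have "h (Some 0) \<in> {Some 0, None}" using axis[OF h(1)] by blast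
    then have "h = rot a" using ab h by (intro sphere_fun_eqI) auto
    then show ?thesis using h by (auto simp: R_def)
  qed
  have swap_case: "\<exists>c\<in>R. h = inversion c" if h: "h \<in> H" "h None \<noteq> None" for h
  proof -
    have "h None \<in> {Some 0, None}" "h (Some 0) \<in> {Some 0, None}" using axis[OF h(1)] by blast+
    then have "h (Some 0) = None" using h(2) apply_eq_iff[OF h(1), of "Some 0" None] by auto
    then obtain c where c: "c \<in> R" "h \<circ> inversion 1 = rot c"
      using fix_case[of "h \<circ> inversion 1"] comp_mem[OF h(1) inv1] by auto
    have "h = (h \<circ> inversion 1) \<circ> inversion 1"
      by (simp add: comp_assoc inversion_inversion rot_1)
    then show ?thesis using c by (auto simp: rot_inversion)
  qed
  have "rot c \<in> H" "inversion c \<in> H" if "c ^ m = 1" for c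
  proof -
    show "rot c \<in> H" using that R by (auto simp: R_def)
    then show "inversion c \<in> H" using comp_mem[OF _ inv1, of "rot c"] by (simp add: rot_inversion)
  qed
  then have "H = dihedral_maps m"
    using fix_case swap_case by (fastforce simp: dihedral_maps_def R)
  moreover have "n dvd m"
  proof -
    have group: "finite_perm_group (rot ` {c. c ^ k = 1})" if "k > 0" for k
    proof
      show "finite (rot ` {c. c ^ k = 1})" using that by (intro finite_imageI finite_roots_unity) simp
      show "id \<in> rot ` {c. c ^ k = 1}" by (rule image_eqI[of _ _ 1]) (simp_all add: rot_1)
      show "f \<circ> g \<in> rot ` {c. c ^ k = 1}" if "f \<in> rot ` {c. c ^ k = 1}" "g \<in> rot ` {c. c ^ k = 1}" for f g
        using that by (auto simp: rot_rot power_mult_distrib)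
      fix f assume "f \<in> rot ` {c. c ^ k = 1}"
      then obtain c where "c ^ k = 1" "f = rot c" by auto
      then show "\<exists>g\<in>rot ` {c. c ^ k = 1}. g \<circ> f = id \<and> f \<circ> g = id"
        using root_of_unity_nonzero[OF that, of c]
        by (intro bexI[of _ "rot (inverse c)"]) (auto simp: rot_rot rot_1 power_inverse)
    qed
    have card: "card (rot ` {c. c ^ k = 1}) = k" if "k > 0" for k
      using that by (subst card_image) (auto simp: inj_on_def rot_inject card_roots_unity_eq)
    have "rot ` {c. c ^ n = 1} \<subseteq> rot ` {c. c ^ m = 1}"
      using n(2) unfolding R[symmetric] by (auto simp: R_def dihedral_maps_def)
    then have "card (rot ` {c. c ^ n = 1}) dvd card (rot ` {c. c ^ m = 1})"
      using finite_perm_group.card_dvd[OF group group] n m by blast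
    then show ?thesis using card n m by simp
  qed
  then obtain p where "m = p * n" by (metis dvd_def mult.commute)
  ultimately show ?thesis using that[of p] m by simp
qed

lemma conj_mem_stabilizer_iff:
  assumes g: "g \<in> moebius_maps" and f: "f \<in> moebius_maps"
  shows "g \<circ> f \<circ> inv' g \<in> moebius_stabilizer \<alpha> \<longleftrightarrow> f \<in> moebius_stabilizer (inv' g ` \<alpha>)"
proof -
  have "(g \<circ> f \<circ> inv' g) ` \<alpha> = g ` f ` inv' g ` \<alpha>" by (simp add: image_comp)
  moreover have "\<alpha> = g ` inv' g ` \<alpha>" using g by (simp add: image_image)
  ultimately have "(g \<circ> f \<circ> inv' g) ` \<alpha> = \<alpha> \<longleftrightarrow> f ` inv' g ` \<alpha> = inv' g ` \<alpha>"
    using moebius_image_eq_iff[OF g] by metis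
  then show ?thesis
    using f g comp_mem_moebius inv_mem_moebius by (simp add: moebius_stabilizer_iff)
qed

text \<open>Conjugation by \<open>g\<close> is injective and maps the finite set \<open>dihedral_maps 2\<close> into itself, so no element
  from outside can be mapped into it.\<close>

lemma conj_dihedral_maps_2:
  assumes g: "g \<in> moebius_maps" and f: "f \<in> moebius_maps"
    and norm: "\<And>f. f \<in> dihedral_maps 2 \<Longrightarrow> \<exists>f'\<in>dihedral_maps 2. g \<circ> f = f' \<circ> g"
  shows "g \<circ> f \<circ> inv' g \<in> dihedral_maps 2 \<longleftrightarrow> f \<in> dihedral_maps 2"
proof -
  let ?c = "\<lambda>f. g \<circ> f \<circ> inv' g"
  have ginv: "g \<circ> inv' g = id" "inv' g \<circ> g = id" using g by (auto simp: fun_eq_iff)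
  have mem: "?c f \<in> dihedral_maps 2" if "f \<in> dihedral_maps 2" for f
  proof -
    obtain f' where "f' \<in> dihedral_maps 2" "g \<circ> f = f' \<circ> g" using norm \<open>f \<in> dihedral_maps 2\<close> by blast
    then show ?thesis by (simp add: comp_assoc ginv)
  qed
  have inj: "f = h" if "?c f = ?c h" for f h
  proof -
    have "inv' g \<circ> ?c f \<circ> g = f" for f
      using g by (simp add: fun_eq_iff)
    then show ?thesis using that by metis
  qed
  have "?c ` dihedral_maps 2 = dihedral_maps 2"
  proof (rule endo_inj_surj)
    show "finite (dihedral_maps 2)" by (simp add: dihedral_maps_2)
    show "inj_on ?c (dihedral_maps 2)" using inj by (auto intro: inj_onI)
  qed (use mem in auto)
  then show ?thesis using mem inj by (metis (no_types, lifting) imageE)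
qed

section \<open>Stabilizers equal to the standard dihedral group\<close>

text \<open>The classification applied to the stabilizer; the dihedral subgroup rules out a common fixed point.\<close>

lemma polyhedral_or_invariant_pair:
  assumes "finite \<alpha>" "card \<alpha> \<ge> 3" and n: "n \<ge> 2" and D: "dihedral_maps n \<subseteq> moebius_stabilizer \<alpha>"
    and not_poly: "\<not> moebius_group\<lparr>carrier := moebius_stabilizer \<alpha>\<rparr> \<cong> alt_group 5"
      "\<not> moebius_group\<lparr>carrier := moebius_stabilizer \<alpha>\<rparr> \<cong> sym_group 4"
      "\<not> moebius_group\<lparr>carrier := moebius_stabilizer \<alpha>\<rparr> \<cong> alt_group 4"
  obtains x y where "x \<noteq> y" "\<And>h. h \<in> moebius_stabilizer \<alpha> \<Longrightarrow> h ` {x, y} = {x, y}"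
proof -
  interpret two_point_group "moebius_stabilizer \<alpha>"
    by (rule two_point_group_moebius[OF finite_perm_group_stabilizer[OF assms(1,2)]])
       (auto simp: moebius_stabilizer_iff)
  have eq: "comp_group (moebius_stabilizer \<alpha>) = moebius_group\<lparr>carrier := moebius_stabilizer \<alpha>\<rparr>"
    by (simp add: moebius_group_def)
  show ?thesis
  proof (cases rule: classification)
    case (fixed_point x)
    then show ?thesis using dihedral_no_fixed_point[OF n, of x] D by blast
  next
    case (invariant_pair x y)
    then show ?thesis by (rule that)
  qed (use not_poly in \<open>simp_all add: eq\<close>)
qed

text \<open>Replacing \<open>\<alpha>\<close> by its preimage under \<open>g\<close> conjugates the stabilizer and moves its axis to \<open>{0, \<infinity>}\<close>,
  while the Klein four-group stays in place because \<open>g\<close> normalizes it.\<close>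

lemma conjugated_axis:
  assumes \<alpha>: "finite \<alpha>" "card \<alpha> \<ge> 3" and D: "dihedral_maps 2 \<subseteq> moebius_stabilizer \<alpha>"
    and g: "g \<in> moebius_maps"
    and norm: "\<And>f. f \<in> dihedral_maps 2 \<Longrightarrow> \<exists>f'\<in>dihedral_maps 2. g \<circ> f = f' \<circ> g"
    and axis: "\<And>h. h \<in> moebius_stabilizer \<alpha> \<Longrightarrow> h ` g ` {Some 0, None} = g ` {Some 0, None}"
    and maximal: "\<And>p. p \<ge> 2 \<Longrightarrow> \<not> union_of_some ((`) g ` orbit_family (2 * p)) \<alpha>"
  shows "moebius_stabilizer \<alpha> = dihedral_maps 2"
proof -
  let ?\<beta> = "inv' g ` \<alpha>"
  have inj: "inj_on (inv' g) \<alpha>" using bij_moebius[OF inv_mem_moebius[OF g]] by (meson bij_is_inj inj_on_subset subset_UNIV)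
  then have \<beta>: "finite ?\<beta>" "card ?\<beta> \<ge> 3" using \<alpha> by (simp_all add: card_image)
  have D\<beta>: "dihedral_maps 2 \<subseteq> moebius_stabilizer ?\<beta>"
  proof
    fix f assume f: "f \<in> dihedral_maps 2"
    then have fM: "f \<in> moebius_maps" using dihedral_maps_subset[of 2] by auto
    have "g \<circ> f \<circ> inv' g \<in> moebius_stabilizer \<alpha>"
      using conj_dihedral_maps_2[OF g fM norm] f D by blast
    then show "f \<in> moebius_stabilizer ?\<beta>" using conj_mem_stabilizer_iff[OF g fM] by simp
  qed
  have axis\<beta>: "h ` {Some 0, None} = {Some 0, None}" if h: "h \<in> moebius_stabilizer ?\<beta>" for h
  proof -
    have "g \<circ> h \<circ> inv' g \<in> moebius_stabilizer \<alpha>"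
      using h conj_mem_stabilizer_iff[OF g, of h] by (simp add: moebius_stabilizer_iff)
    from axis[OF this] have "(\<lambda>x. g (h (inv' g x))) ` g ` {Some 0, None} = g ` {Some 0, None}"
      by (simp add: comp_def)
    then have "g ` h ` {Some 0, None} = g ` {Some 0, None}" using g by (simp add: image_image)
    then show ?thesis by (simp only: moebius_image_eq_iff[OF g])
  qed
  obtain p where p: "p > 0" "moebius_stabilizer ?\<beta> = dihedral_maps (p * 2)"
    by (rule standard_axis[OF finite_perm_group_stabilizer[OF \<beta>] moebius_stabilizer_subset pos2 D\<beta> axis\<beta>])
  have "union_of_some ((`) g ` orbit_family (2 * p)) \<alpha>"
    using p union_of_orbits_iff[of "2 * p" ?\<beta>] by (simp add: union_of_image_family[OF g] mult.commute)
  then have "p = 1" using maximal[of p] p(1) by linarith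
  then have S\<beta>: "moebius_stabilizer ?\<beta> = dihedral_maps 2" using p by simp
  have "f \<in> dihedral_maps 2" if f: "f \<in> moebius_stabilizer \<alpha>" for f
  proof -
    have fM: "inv' g \<circ> f \<circ> g \<in> moebius_maps"
      using f g comp_mem_moebius inv_mem_moebius by (simp add: moebius_stabilizer_iff)
    have eq: "g \<circ> (inv' g \<circ> f \<circ> g) \<circ> inv' g = f" using g by (simp add: fun_eq_iff)
    then have "inv' g \<circ> f \<circ> g \<in> dihedral_maps 2"
      using conj_mem_stabilizer_iff[OF g fM, of \<alpha>] f S\<beta> by simp
    then show ?thesis using conj_dihedral_maps_2[OF g fM norm] eq by simp
  qed
  then show ?thesis using D by blast
qed

text \<open>The orbit condition puts a conjugate of a dihedral group of order at least 8 into a group of order 4.\<close>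

lemma not_union_of_conjugated_orbits:
  assumes S: "moebius_stabilizer \<alpha> = dihedral_maps 2" and p: "p \<ge> 2"
    and g: "g \<in> moebius_maps"
    and norm: "\<And>f. f \<in> dihedral_maps 2 \<Longrightarrow> \<exists>f'\<in>dihedral_maps 2. g \<circ> f = f' \<circ> g"
  shows "\<not> union_of_some ((`) g ` orbit_family (2 * p)) \<alpha>"
proof
  assume "union_of_some ((`) g ` orbit_family (2 * p)) \<alpha>"
  then have D: "dihedral_maps (2 * p) \<subseteq> moebius_stabilizer (inv' g ` \<alpha>)"
    using p union_of_orbits_iff[of "2 * p"] by (simp add: union_of_image_family[OF g])
  have "dihedral_maps (2 * p) \<subseteq> dihedral_maps 2"
  proof
    fix f assume f: "f \<in> dihedral_maps (2 * p)"
    then have fM: "f \<in> moebius_maps" using dihedral_maps_subset[of "2 * p"] p by auto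
    have "f \<in> moebius_stabilizer (inv' g ` \<alpha>)" using f D by blast
    then have "g \<circ> f \<circ> inv' g \<in> dihedral_maps 2" using conj_mem_stabilizer_iff[OF g fM, of \<alpha>] S by simp
    then show "f \<in> dihedral_maps 2" using conj_dihedral_maps_2[OF g fM norm] by simp
  qed
  then have "2 * p \<le> 2" using p by (intro dihedral_maps_subset_imp_le) auto
  then show False using p by simp
qed

theorem theorem10:
  fixes n :: nat
  assumes "n \<ge> 2"
  shows "moebius_group\<lparr>carrier := standard_dihedral n\<rparr> \<cong> dihedral_group n \<and>
    (\<forall>\<alpha> :: sphere set. finite \<alpha> \<longrightarrow> card \<alpha> \<ge> 3 \<longrightarrow>
      (moebius_stabilizer \<alpha> = standard_dihedral n \<longleftrightarrow>
        union_of_some (orbit_family n) \<alpha> \<and>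
        (\<forall>p::nat. p \<ge> 2 \<longrightarrow> \<not> union_of_some (orbit_family (p * n)) \<alpha>) \<and>
        (n = 2 \<longrightarrow> (\<forall>p::nat. p \<ge> 2 \<longrightarrow> \<not> union_of_some ((`) phi ` orbit_family (2 * p)) \<alpha>)) \<and>
        (n = 2 \<longrightarrow> (\<forall>p::nat. p \<ge> 2 \<longrightarrow> \<not> union_of_some ((`) psi ` orbit_family (2 * p)) \<alpha>)) \<and>
        \<not> moebius_group\<lparr>carrier := moebius_stabilizer \<alpha>\<rparr> \<cong> alt_group 5 \<and>
        \<not> moebius_group\<lparr>carrier := moebius_stabilizer \<alpha>\<rparr> \<cong> sym_group 4 \<and>
        \<not> moebius_group\<lparr>carrier := moebius_stabilizer \<alpha>\<rparr> \<cong> alt_group 4))"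
proof (intro conjI allI impI)
  have n: "n > 0" using assms by simp
  show "moebius_group\<lparr>carrier := standard_dihedral n\<rparr> \<cong> dihedral_group n"
    by (rule standard_dihedral_iso[OF n])
  fix \<alpha> :: "sphere set"
  assume \<alpha>: "finite \<alpha>" "card \<alpha> \<ge> 3"
  let ?S = "moebius_stabilizer \<alpha>"
  show "?S = standard_dihedral n \<longleftrightarrow>
        union_of_some (orbit_family n) \<alpha> \<and>
        (\<forall>p::nat. p \<ge> 2 \<longrightarrow> \<not> union_of_some (orbit_family (p * n)) \<alpha>) \<and>
        (n = 2 \<longrightarrow> (\<forall>p::nat. p \<ge> 2 \<longrightarrow> \<not> union_of_some ((`) phi ` orbit_family (2 * p)) \<alpha>)) \<and>
        (n = 2 \<longrightarrow> (\<forall>p::nat. p \<ge> 2 \<longrightarrow> \<not> union_of_some ((`) psi ` orbit_family (2 * p)) \<alpha>)) \<and>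
        \<not> moebius_group\<lparr>carrier := ?S\<rparr> \<cong> alt_group 5 \<and>
        \<not> moebius_group\<lparr>carrier := ?S\<rparr> \<cong> sym_group 4 \<and>
        \<not> moebius_group\<lparr>carrier := ?S\<rparr> \<cong> alt_group 4"
    (is "_ \<longleftrightarrow> ?orbits \<and> ?rot \<and> ?phi \<and> ?psi \<and> ?A5 \<and> ?S4 \<and> ?A4")
  proof
    assume "?S = standard_dihedral n"
    then have S: "?S = dihedral_maps n" by (simp add: standard_dihedral_eq[OF n])
    have ?orbits using S union_of_orbits_iff[OF n] by simp
    moreover have "\<not> union_of_some (orbit_family (p * n)) \<alpha>" if p: "p \<ge> 2" for p
    proof
      assume "union_of_some (orbit_family (p * n)) \<alpha>"
      then have "dihedral_maps (p * n) \<subseteq> dihedral_maps n"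
        using S union_of_orbits_iff[of "p * n" \<alpha>] p n by simp
      then have "p * n \<le> n" using p n by (intro dihedral_maps_subset_imp_le) auto
      then show False using p n by simp
    qed
    moreover have ?phi ?psi
      using not_union_of_conjugated_orbits[of \<alpha>] S phi_mem phi_normalizes psi_mem psi_normalizes by blast+
    moreover have ?A5 ?S4 ?A4 unfolding S by (rule dihedral_not_polyhedral[OF n])+
    ultimately show "?orbits \<and> ?rot \<and> ?phi \<and> ?psi \<and> ?A5 \<and> ?S4 \<and> ?A4" by blast
  next
    assume asm: "?orbits \<and> ?rot \<and> ?phi \<and> ?psi \<and> ?A5 \<and> ?S4 \<and> ?A4"
    then have D: "dihedral_maps n \<subseteq> ?S" using union_of_orbits_iff[OF n] by simp
    obtain x y where xy: "x \<noteq> y" "\<And>h. h \<in> ?S \<Longrightarrow> h ` {x, y} = {x, y}"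
      using polyhedral_or_invariant_pair[OF \<alpha> assms D] asm by blast
    have "{x, y} = {Some 0, None} \<or> n = 2 \<and> ({x, y} = phi ` {Some 0, None} \<or> {x, y} = psi ` {Some 0, None})"
      using dihedral_invariant_pair[OF assms xy(1)] xy(2) D by blast
    then consider "{x, y} = {Some 0, None}" | "n = 2" "{x, y} = phi ` {Some 0, None}"
      | "n = 2" "{x, y} = psi ` {Some 0, None}" by blast
    then have "?S = dihedral_maps n"
    proof cases
      case 1
      have axis: "h ` {Some 0, None} = {Some 0, None}" if "h \<in> ?S" for h
        using xy(2)[OF that] unfolding 1 .
      obtain p where p: "p > 0" "?S = dihedral_maps (p * n)"
        by (rule standard_axis[OF finite_perm_group_stabilizer[OF \<alpha>] moebius_stabilizer_subset n D axis])
      then have "union_of_some (orbit_family (p * n)) \<alpha>" using n by (simp add: union_of_orbits_iff)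
      then have "\<not> p \<ge> 2" using asm by blast
      then have "p = 1" using p(1) by simp
      then show ?thesis using p by simp
    next
      case 2
      then show ?thesis
        using conjugated_axis[OF \<alpha> _ phi_mem phi_normalizes] D xy(2) asm by simp
    next
      case 3
      then show ?thesis
        using conjugated_axis[OF \<alpha> _ psi_mem psi_normalizes] D xy(2) asm by simp
    qed
    then show "?S = standard_dihedral n" by (simp add: standard_dihedral_eq[OF n])
  qed
qed

end
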